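(* Let $p \in [1,\infty)$, $-\infty < a < b < \infty$, $c > 0$, and let $\Omega \subset \mathbb{R}$ be a countable set. Let $E$ be either of the spaces $L^p([a,b])$ and $C([a,b])$. Then the set of functions $$\left\{ t \mapsto \mathrm{e}^{-c(t-\omega)^2} : \omega \in \Omega \right\}$$ is complete in $E$ if and only if the series $$\sum_{\omega \in \Omega\setminus\{0\}} |\omega|^{-1}$$ diverges.
   Context: $L^p([a,b])$ and $C([a,b])$ are spaces of complex-valued functions, the latter being the continuous functions with the supremum norm. A subset of a normed space is complete if its (finite) complex linear span is dense. *)

theory Defs
  imports "HOL-Analysis.Analysis" "HOL-Library.Function_Algebras"
begin

text \<open>Complex-valued functions on the real line as a complex vector space with pointwise
  operations; \<open>cfun.span\<close> is the finite complex linear span.\<close>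

interpretation cfun: vector_space "\<lambda>(z :: complex) (f :: real \<Rightarrow> complex) t. z * f t"
  by unfold_locales (auto simp: fun_eq_iff algebra_simps)

text \<open>Elements of \<open>L\<^sup>p([a,b])\<close> and \<open>C([a,b])\<close> are represented by functions on the whole real
  line, of which only the values on \<open>[a,b]\<close> matter; in \<open>L\<^sup>p\<close>, functions that agree almost
  everywhere are not identified, so \<open>Lp_norm\<close> is a seminorm on representatives. The spans of
  a family and of its restrictions or classes correspond, so density is unaffected.\<close>

definition Lp_space :: "real \<Rightarrow> real \<Rightarrow> real \<Rightarrow> (real \<Rightarrow> complex) set" where
  "Lp_space p a b = {f. f \<in> borel_measurable (lebesgue_on {a..b}) \<and>
     integrable (lebesgue_on {a..b}) (\<lambda>t. cmod (f t) powr p)}"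

definition Lp_norm :: "real \<Rightarrow> real \<Rightarrow> real \<Rightarrow> (real \<Rightarrow> complex) \<Rightarrow> real" where
  "Lp_norm p a b f = (integral\<^sup>L (lebesgue_on {a..b}) (\<lambda>t. cmod (f t) powr p)) powr (1 / p)"

definition C_space :: "real \<Rightarrow> real \<Rightarrow> (real \<Rightarrow> complex) set" where
  "C_space a b = {f. continuous_on {a..b} f}"

definition sup_norm :: "real \<Rightarrow> real \<Rightarrow> (real \<Rightarrow> complex) \<Rightarrow> real" where
  "sup_norm a b f = (SUP t\<in>{a..b}. cmod (f t))"

definition complete_in ::
    "(real \<Rightarrow> complex) set \<Rightarrow> ((real \<Rightarrow> complex) \<Rightarrow> real) \<Rightarrow> (real \<Rightarrow> complex) set \<Rightarrow> bool" where
  "complete_in E nrm S \<longleftrightarrow> S \<subseteq> E \<and>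
     (\<forall>f\<in>E. \<forall>\<epsilon>>0. \<exists>g\<in>cfun.span S. nrm (\<lambda>t. f t - g t) < \<epsilon>)"

definition gaussian_translates :: "real \<Rightarrow> real set \<Rightarrow> (real \<Rightarrow> complex) set" where
  "gaussian_translates c \<Omega> = {\<lambda>t. complex_of_real (exp (- c * (t - \<omega>)\<^sup>2)) | \<omega>. \<omega> \<in> \<Omega>}"

end

theory Submission
  imports Defs
begin

text \<open>
  Since \<open>exp (- c * (t - \<omega>)\<^sup>2)\<close> is \<open>exp (- c * t\<^sup>2) * exp (2 * c * \<omega> * t)\<close> up to a constant
  factor, and the weight \<open>exp (- c * t\<^sup>2)\<close> is bounded above and away from zero on \<open>[a,b]\<close>, the
  question is whether the exponentials \<open>exp (l * t)\<close> with \<open>l\<close> in \<open>2 * c * \<Omega>\<close> span a dense subspace.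
  This is the Muntz problem on an interval away from the origin, with exponents of both signs.

  Divergence implies density. One of the two signs already carries a divergent sum, so after a
  reflection all exponents are decay rates \<open>l > 0\<close> on an interval \<open>[0,L]\<close>. Von Golitschek's
  argument approximates \<open>exp (- q * s)\<close> by finitely many \<open>exp (- l * s)\<close> with uniform error at most the
  product of the numbers \<open>\<bar>1 - q / l\<bar>\<close> (\<open>muntz_error_bound\<close>). Multiplying everything by a fixed
  exponential shifts all exponents; after a large shift every factor is at most
  \<open>exp (- (q + 1) / (l + s))\<close>, so the product tends to zero even if the exponents accumulate at a
  finite point (\<open>decaying_exponential_in_closure\<close>). Hence all \<open>exp (- n * s)\<close> are reached, and
  the Weierstrass theorem in the variable \<open>exp (- s)\<close> gives every continuous function. Continuous
  functions are dense in the Lebesgue spaces, so uniform density suffices for both spaces.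

  Convergence excludes density. Choose \<open>\<omega>0\<close> outside \<open>\<Omega>\<close> and divide by the Gaussian centred at
  \<open>\<omega>0\<close>: it is enough to bound the \<open>L\<^sup>1\<close> distance from the constant one to the
  real exponential sums with frequencies \<open>l = 2 * c * (\<omega> - \<omega>0)\<close>, none of which is zero, from below. For one such
  frequency and a step \<open>d > 0\<close> consider the operator
  \<open>(f (t + d) + f (t - d)) / 2 - (f (t + 2 * d) - f (t - 2 * d)) / (4 * sinh (d * l))\<close>.
  It annihilates \<open>exp (l * t)\<close>, fixes constants, and shortens the interval on which a formula for
  \<open>f\<close> is known by \<open>2 * d\<close> at each end. On imaginary frequencies \<open>\<i> * y\<close> its squared symbol is
  \<open>cos (d * y)\<^sup>2 * (1 + sin (d * y)\<^sup>2 / sinh (d * l)\<^sup>2)\<close>, which is at most one as soon as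
  \<open>\<bar>d * l\<bar> \<ge> 1\<close>, so the operator is then an \<open>L\<^sup>2\<close> contraction (\<open>annihilator_L2_bound\<close>).
  The steps \<open>d = 1 / \<bar>l\<bar>\<close> are summable; for the finitely many small frequencies a smaller step is
  used at the cost of a constant. Composing the operators for all frequencies of a given
  exponential sum therefore costs a bounded factor and a bounded part of the interval, uniformly in
  the sum, and leaves a nonzero constant (\<open>constant_term_L2_bound\<close>). Averaging over a window
  beforehand turns \<open>L\<^sup>1\<close> smallness into \<open>L\<^sup>2\<close> smallness (\<open>window_average_bound\<close>).
\<close>

section \<open>Approximating one decaying exponential by others\<close>

text \<open>Adding one more rate \<open>m\<close> replaces the current error \<open>Q\<close> by the solution \<open>W\<close> of
  \<open>W' + m * W = (m - q) * Q\<close> with \<open>W 0 = 0\<close>, which is again \<open>exp (- q * s)\<close> minus a combination of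
  the admitted exponentials, now including \<open>exp (- m * s)\<close>. The integrating factor
  \<open>exp (m * s)\<close> shows \<open>\<bar>W\<bar> \<le> \<bar>m - q\<bar> / m * sup \<bar>Q\<bar>\<close>, which is the new factor of the product. In the
  proof \<open>V\<close> is \<open>exp (m * s) * W s\<close>.\<close>

lemma muntz_error_bound:
  fixes q L :: real
  assumes "finite S" "\<And>l. l \<in> S \<Longrightarrow> 0 < l" "q \<notin> S" "0 \<le> q"
  shows "\<exists>a. \<forall>s\<in>{0..L}. \<bar>exp (- q * s) - (\<Sum>l\<in>S. a l * exp (- l * s))\<bar> \<le> (\<Prod>l\<in>S. \<bar>1 - q / l\<bar>)"
  using assms(1-3)
proof (induction S rule: finite_induct)
  case empty
  show ?case using assms(4) by auto
next
  case (insert m S)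
  have "\<exists>a. \<forall>s\<in>{0..L}. \<bar>exp (- q * s) - (\<Sum>l\<in>S. a l * exp (- l * s))\<bar> \<le> (\<Prod>l\<in>S. \<bar>1 - q / l\<bar>)"
    by (rule insert.IH) (use insert.prems in auto)
  then obtain a where a: "\<And>s. s \<in> {0..L} \<Longrightarrow>
      \<bar>exp (- q * s) - (\<Sum>l\<in>S. a l * exp (- l * s))\<bar> \<le> (\<Prod>l\<in>S. \<bar>1 - q / l\<bar>)"
    by blast
  define B where "B = (\<Prod>l\<in>S. \<bar>1 - q / l\<bar>)"
  define Q where "Q s = exp (- q * s) - (\<Sum>l\<in>S. a l * exp (- l * s))" for s
  define b where "b l = a l * (m - q) / (m - l)" for l
  define V where "V s = exp ((m - q) * s) - 1 - (\<Sum>l\<in>S. b l * (exp ((m - l) * s) - 1))" for s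
  define a' where "a' l = (if l = m then 1 - (\<Sum>l\<in>S. b l) else b l)" for l
  have m: "0 < m" "m \<noteq> q" "m \<notin> S" using insert by auto
  have V': "(V has_real_derivative (m - q) * (exp (m * s) * Q s)) (at s)" for s
  proof -
    have b: "b l * (m - l) = (m - q) * a l" if "l \<in> S" for l
      using that m by (auto simp: b_def)
    have "(V has_real_derivative (m - q) * exp ((m - q) * s) -
            (\<Sum>l\<in>S. b l * ((m - l) * exp ((m - l) * s)))) (at s)"
      unfolding V_def by (auto intro!: derivative_eq_intros sum.cong)
    also have "(\<Sum>l\<in>S. b l * ((m - l) * exp ((m - l) * s))) =
        (m - q) * (\<Sum>l\<in>S. a l * exp ((m - l) * s))"
      unfolding sum_distrib_left by (intro sum.cong refl) (metis b mult.assoc)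
    also have "(m - q) * exp ((m - q) * s) - (m - q) * (\<Sum>l\<in>S. a l * exp ((m - l) * s))
       = (m - q) * (exp (m * s) * Q s)"
      by (simp add: Q_def algebra_simps sum_distrib_left exp_diff exp_minus divide_inverse)
    finally show ?thesis .
  qed
  define K where "K = \<bar>m - q\<bar> * B / m"
  have E': "((\<lambda>s. K * exp (m * s)) has_real_derivative \<bar>m - q\<bar> * B * exp (m * s)) (at s)" for s
    using m by (auto intro!: derivative_eq_intros simp: K_def)
  have Vb: "\<bar>V s\<bar> \<le> K * exp (m * s)" if s: "s \<in> {0..L}" for s
  proof -
    have b: "\<bar>(m - q) * (exp (m * u) * Q u)\<bar> \<le> \<bar>m - q\<bar> * B * exp (m * u)" if "0 \<le> u" "u \<le> s" for u
    proof -
      have "\<bar>Q u\<bar> \<le> B" using a[of u] that s unfolding Q_def B_def by auto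
      then have "\<bar>m - q\<bar> * (exp (m * u) * \<bar>Q u\<bar>) \<le> \<bar>m - q\<bar> * (exp (m * u) * B)"
        by (intro mult_left_mono) auto
      then show ?thesis by (simp add: abs_mult mult_ac)
    qed
    have V0: "V 0 = 0" by (simp add: V_def)
    have K0: "K \<ge> 0" unfolding K_def B_def using m by (auto intro!: divide_nonneg_pos mult_nonneg_nonneg prod_nonneg)
    have "K * exp (m * 0) - V 0 \<le> K * exp (m * s) - V s"
    proof (rule DERIV_nonneg_imp_nondecreasing[where f="\<lambda>s. K * exp (m * s) - V s"])
      show "0 \<le> s" using s by simp
      fix u assume "0 \<le> u" "u \<le> s"
      then show "\<exists>y. ((\<lambda>s. K * exp (m * s) - V s) has_real_derivative y) (at u) \<and> 0 \<le> y"
        using b[of u] by (intro exI[of _ "\<bar>m - q\<bar> * B * exp (m * u) - (m - q) * (exp (m * u) * Q u)"] conjI DERIV_diff E' V') linarith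
    qed
    moreover have "K * exp (m * 0) + V 0 \<le> K * exp (m * s) + V s"
    proof (rule DERIV_nonneg_imp_nondecreasing[where f="\<lambda>s. K * exp (m * s) + V s"])
      show "0 \<le> s" using s by simp
      fix u assume "0 \<le> u" "u \<le> s"
      then show "\<exists>y. ((\<lambda>s. K * exp (m * s) + V s) has_real_derivative y) (at u) \<and> 0 \<le> y"
        using b[of u] by (intro exI[of _ "\<bar>m - q\<bar> * B * exp (m * u) + (m - q) * (exp (m * u) * Q u)"] conjI DERIV_add E' V') linarith
    qed
    ultimately show ?thesis using V0 K0 by simp
  qed
  show ?case
  proof (intro exI[of _ a'] ballI)
    fix s assume s: "s \<in> {0..L}"
    have "(\<Sum>l\<in>insert m S. a' l * exp (- l * s)) = (1 - (\<Sum>l\<in>S. b l)) * exp (- m * s) + (\<Sum>l\<in>S. b l * exp (- l * s))"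
      using insert(1,2) m by (auto simp: a'_def intro!: sum.cong)
    moreover have "exp (- m * s) * V s = exp (- q * s) - exp (- m * s) - (\<Sum>l\<in>S. b l * (exp (- l * s) - exp (- m * s)))"
    proof -
      have e: "exp (- m * s) * exp ((m - l) * s) = exp (- l * s)" for l
        by (simp add: algebra_simps flip: exp_add)
      have "exp (- m * s) * V s = exp (- m * s) * exp ((m - q) * s) - exp (- m * s)
          - (\<Sum>l\<in>S. b l * (exp (- m * s) * exp ((m - l) * s) - exp (- m * s)))"
        unfolding V_def right_diff_distrib sum_distrib_left by (simp add: mult_ac)
      then show ?thesis unfolding e .
    qed
    ultimately have "exp (- q * s) - (\<Sum>l\<in>insert m S. a' l * exp (- l * s)) = exp (- m * s) * V s"
      by (simp add: right_diff_distrib left_diff_distrib sum_subtractf sum_distrib_right)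
    then have "\<bar>exp (- q * s) - (\<Sum>l\<in>insert m S. a' l * exp (- l * s))\<bar> = exp (- m * s) * \<bar>V s\<bar>"
      by (simp add: abs_mult)
    also have "\<dots> \<le> exp (- m * s) * (K * exp (m * s))"
      using Vb[OF s] by (intro mult_left_mono) auto
    also have "\<dots> = K" by (simp add: exp_minus)
    also have "\<dots> = \<bar>1 - q / m\<bar> * B"
      using m by (simp add: K_def divide_simps)
    also have "\<dots> = (\<Prod>l\<in>insert m S. \<bar>1 - q / l\<bar>)" using insert by (simp add: B_def)
    finally show "\<bar>exp (- q * s) - (\<Sum>l\<in>insert m S. a' l * exp (- l * s))\<bar> \<le> (\<Prod>l\<in>insert m S. \<bar>1 - q / l\<bar>)" .
  qed
qed

section \<open>Comparing sums of reciprocals\<close>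

text \<open>Only finitely many terms of a summable family can exceed \<open>d\<close>. This form of the comparison test
  treats accumulation points of the exponents and the finitely many small exponents at the same time.\<close>

lemma summable_on_trans_or_large:
  fixes f g :: "'a \<Rightarrow> real"
  assumes f: "f summable_on A" and nonneg: "\<And>x. x \<in> A \<Longrightarrow> 0 \<le> f x" "\<And>x. x \<in> A \<Longrightarrow> 0 \<le> g x"
    and d: "0 < d" and alt: "\<And>x. x \<in> A \<Longrightarrow> g x \<le> C * f x \<or> d \<le> f x"
  shows "g summable_on A"
proof -
  define X where "X = {x \<in> A. d \<le> f x}"
  have "finite X"
  proof (rule ccontr)
    assume inf: "infinite X"
    obtain n where n: "real n * d > infsum f A"
      using d by (metis reals_Archimedean3)
    obtain F where F: "F \<subseteq> X" "card F = n" "finite F"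
      using infinite_arbitrarily_large[OF inf] by metis
    have "real n * d \<le> sum f F"
      using sum_mono[of F "\<lambda>_. d" f] F by (auto simp: X_def)
    also have "\<dots> \<le> infsum f A"
      using F f nonneg by (intro finite_sum_le_infsum) (auto simp: X_def)
    finally show False using n by simp
  qed
  have "(\<lambda>x. C * f x) summable_on (A - X)"
    using f by (intro summable_on_cmult_right) (auto intro: summable_on_subset_banach)
  then have "g summable_on (A - X)"
  proof (rule summable_on_comparison_test)
    fix x assume x: "x \<in> A - X"
    then show "g x \<le> C * f x" "0 \<le> g x" using alt[of x] nonneg by (auto simp: X_def)
  qed
  moreover have "g summable_on X" using \<open>finite X\<close> by simp
  ultimately have "g summable_on ((A - X) \<union> X)" by (intro summable_on_Un_disjoint) auto
  moreover have "(A - X) \<union> X = A" by (auto simp: X_def)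
  ultimately show ?thesis by simp
qed

text \<open>If the shifted sums stayed bounded, then the shifted reciprocals would be summable, and \<open>l\<close> and
  \<open>l + s\<close> are comparable for \<open>l \<ge> 1\<close>, while \<open>1 / (l + s)\<close> is bounded below for \<open>l \<le> 1\<close>.\<close>

lemma shifted_sums_unbounded:
  fixes \<Lambda> :: "real set"
  assumes pos: "\<And>l. l \<in> \<Lambda> \<Longrightarrow> 0 < l" and div: "\<not> inverse summable_on \<Lambda>" and s: "0 \<le> s"
  shows "\<exists>F. finite F \<and> F \<subseteq> \<Lambda> \<and> B < (\<Sum>l\<in>F. inverse (l + s))"
proof (rule ccontr)
  assume "\<not> ?thesis"
  then have "(\<lambda>l. inverse (l + s)) summable_on \<Lambda>"
    using pos s by (intro nonneg_bdd_above_summable_on bdd_aboveI[of _ B]) (auto simp: not_less less_imp_le)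
  then have "inverse summable_on \<Lambda>"
  proof (rule summable_on_trans_or_large[where d="inverse (1 + s)" and C="1 + s"])
    fix l assume "l \<in> \<Lambda>"
    then have l: "0 < l" by (rule pos)
    show "0 \<le> inverse (l + s)" "0 \<le> inverse l" using l s by auto
    show "inverse l \<le> (1 + s) * inverse (l + s) \<or> inverse (1 + s) \<le> inverse (l + s)"
    proof (cases "l \<le> 1")
      case True
      then show ?thesis using l s by (auto intro!: le_imp_inverse_le)
    next
      case False
      then have "l + s \<le> (1 + s) * l" using s mult_right_mono[of 1 l s] by (simp add: algebra_simps)
      then show ?thesis using l s by (simp add: divide_simps)
    qed
  qed (use s in auto)
  then show False using div by simp
qed

section \<open>Uniform closures of complex spans\<close>

definition uniform_closure :: "real set \<Rightarrow> (real \<Rightarrow> complex) set \<Rightarrow> (real \<Rightarrow> complex) set" where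
  "uniform_closure I S = {f. \<forall>e>0. \<exists>g\<in>cfun.span S. \<forall>t\<in>I. cmod (f t - g t) < e}"

lemma span_subset_uniform_closure: "cfun.span S \<subseteq> uniform_closure I S"
  unfolding uniform_closure_def by force

lemma uniform_closure_subspace: "cfun.subspace (uniform_closure I S)"
proof (rule cfun.subspaceI)
  show "0 \<in> uniform_closure I S"
    using span_subset_uniform_closure cfun.span_zero by blast
next
  fix f g assume f: "f \<in> uniform_closure I S" and g: "g \<in> uniform_closure I S"
  show "f + g \<in> uniform_closure I S"
    unfolding uniform_closure_def
  proof safe
    fix e :: real assume "0 < e"
    then have "0 < e / 2" by simp
    then obtain u v where u: "u \<in> cfun.span S" "\<And>t. t \<in> I \<Longrightarrow> cmod (f t - u t) < e / 2"
      and v: "v \<in> cfun.span S" "\<And>t. t \<in> I \<Longrightarrow> cmod (g t - v t) < e / 2"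
      using f g unfolding uniform_closure_def by blast
    show "\<exists>h\<in>cfun.span S. \<forall>t\<in>I. cmod ((f + g) t - h t) < e"
    proof (intro bexI ballI)
      fix t assume t: "t \<in> I"
      show "cmod ((f + g) t - (u + v) t) < e"
        using norm_triangle_ineq[of "f t - u t" "g t - v t"] u(2)[OF t] v(2)[OF t]
        by (simp add: algebra_simps)
    qed (rule cfun.span_add[OF u(1) v(1)])
  qed
next
  fix z f assume f: "f \<in> uniform_closure I S"
  show "(\<lambda>t. z * f t) \<in> uniform_closure I S"
    unfolding uniform_closure_def
  proof safe
    fix e :: real assume e: "0 < e"
    define d where "d = e / (cmod z + 1)"
    have cz: "0 < cmod z + 1" by (smt (verit) norm_ge_zero)
    have "0 < d" using e cz by (simp add: d_def)
    then obtain u where u: "u \<in> cfun.span S" "\<And>t. t \<in> I \<Longrightarrow> cmod (f t - u t) < d"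
      using f unfolding uniform_closure_def by blast
    show "\<exists>h\<in>cfun.span S. \<forall>t\<in>I. cmod (z * f t - h t) < e"
    proof (intro bexI ballI)
      fix t assume t: "t \<in> I"
      have "cmod (z * f t - z * u t) = cmod z * cmod (f t - u t)"
        by (simp flip: norm_mult add: algebra_simps)
      also have "\<dots> \<le> cmod z * d" using u(2)[OF t] by (intro mult_left_mono) auto
      also have "\<dots> < (cmod z + 1) * d" using \<open>0 < d\<close> by simp
      also have "\<dots> = e" using cz by (simp add: d_def)
      finally show "cmod (z * f t - z * u t) < e" .
    qed (use u cfun.span_scale in auto)
  qed
qed

lemma uniform_closure_trans:
  assumes "T \<subseteq> uniform_closure I S" "f \<in> uniform_closure I T"
  shows "f \<in> uniform_closure I S"
  unfolding uniform_closure_def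
proof safe
  fix e :: real assume "0 < e"
  then have e2: "0 < e / 2" by simp
  obtain u where u: "u \<in> cfun.span T" "\<And>t. t \<in> I \<Longrightarrow> cmod (f t - u t) < e / 2"
    using assms(2) e2 unfolding uniform_closure_def by blast
  have "u \<in> uniform_closure I S"
    using cfun.span_minimal[OF assms(1) uniform_closure_subspace] u(1) by blast
  then obtain v where v: "v \<in> cfun.span S" "\<And>t. t \<in> I \<Longrightarrow> cmod (u t - v t) < e / 2"
    using e2 unfolding uniform_closure_def by blast
  show "\<exists>g\<in>cfun.span S. \<forall>t\<in>I. cmod (f t - g t) < e"
  proof (intro bexI[of _ v] ballI)
    fix t assume t: "t \<in> I"
    show "cmod (f t - v t) < e"
      using norm_triangle_ineq[of "f t - u t" "u t - v t"] u(2)[OF t] v(2)[OF t] by simp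
  qed (use v in auto)
qed

text \<open>Substitutions and bounded weights preserve uniform approximation; reflections, translations and
  the Gaussian weight are all passed through this lemma.\<close>

lemma uniform_closure_transform:
  fixes w :: "real \<Rightarrow> complex" and \<phi> :: "real \<Rightarrow> real"
  assumes f: "f \<in> uniform_closure I S" and \<phi>: "\<And>t. t \<in> J \<Longrightarrow> \<phi> t \<in> I"
    and w: "\<And>t. t \<in> J \<Longrightarrow> cmod (w t) \<le> B"
    and S: "\<And>g. g \<in> S \<Longrightarrow> (\<lambda>t. w t * g (\<phi> t)) \<in> cfun.span T"
  shows "(\<lambda>t. w t * f (\<phi> t)) \<in> uniform_closure J T"
  unfolding uniform_closure_def
proof safe
  fix e :: real assume e: "0 < e"
  define d where "d = e / (\<bar>B\<bar> + 1)"
  have "0 < d" using e by (simp add: d_def)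
  then obtain u where u: "u \<in> cfun.span S" "\<And>t. t \<in> I \<Longrightarrow> cmod (f t - u t) < d"
    using f unfolding uniform_closure_def by blast
  have span: "(\<lambda>t. w t * u (\<phi> t)) \<in> cfun.span T"
    using u(1)
  proof (induction rule: cfun.span_induct_alt)
    case base
    show ?case using cfun.span_zero by (simp add: zero_fun_def)
  next
    case (step c x y)
    have "(\<lambda>t. c * (w t * x (\<phi> t))) + (\<lambda>t. w t * y (\<phi> t)) \<in> cfun.span T"
      using step S by (intro cfun.span_add cfun.span_scale) auto
    also have "(\<lambda>t. c * (w t * x (\<phi> t))) + (\<lambda>t. w t * y (\<phi> t)) = (\<lambda>t. w t * ((\<lambda>t. c * x t) + y) (\<phi> t))"
      by (auto simp: fun_eq_iff algebra_simps)
    finally show ?case .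
  qed
  show "\<exists>h\<in>cfun.span T. \<forall>t\<in>J. cmod (w t * f (\<phi> t) - h t) < e"
  proof (intro bexI[OF _ span] ballI)
    fix t assume t: "t \<in> J"
    have "cmod (w t * f (\<phi> t) - w t * u (\<phi> t)) = cmod (w t) * cmod (f (\<phi> t) - u (\<phi> t))"
      by (simp flip: norm_mult add: algebra_simps)
    also have "\<dots> \<le> \<bar>B\<bar> * d" using u(2)[OF \<phi>[OF t]] w[OF t] by (intro mult_mono) auto
    also have "\<dots> < (\<bar>B\<bar> + 1) * d" using \<open>0 < d\<close> by simp
    also have "\<dots> = e" by (simp add: d_def)
    finally show "cmod (w t * f (\<phi> t) - w t * u (\<phi> t)) < e" .
  qed
qed


lemma span_sum_pointwise:
  assumes "\<And>i. i \<in> F \<Longrightarrow> v i \<in> cfun.span S"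
  shows "(\<lambda>t. \<Sum>i\<in>F. z i * v i t) \<in> cfun.span S"
  using assms
proof (induction F rule: infinite_finite_induct)
  case (insert i F)
  have "(\<lambda>t. z i * v i t) + (\<lambda>t. \<Sum>i\<in>F. z i * v i t) \<in> cfun.span S"
    using insert by (intro cfun.span_add cfun.span_scale) auto
  then show ?case using insert by (simp add: plus_fun_def)
qed (use cfun.span_zero in \<open>simp_all add: zero_fun_def\<close>)

section \<open>Density when the reciprocals diverge\<close>

definition expo :: "real \<Rightarrow> real \<Rightarrow> complex" where
  "expo l t = complex_of_real (exp (l * t))"

text \<open>The factors \<open>\<bar>1 - q / l\<bar>\<close> need not be small, or even less than one, for rates \<open>l\<close> close to zero.
  Multiplying by \<open>exp (- s * t)\<close> moves the problem to the rates \<open>l + s\<close> and the target \<open>q + s\<close>, where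
  the factors are at most \<open>exp (- (q + 1) / (l + s))\<close>; undoing the multiplication
  costs the fixed constant \<open>exp (s * L)\<close>.\<close>

lemma decaying_exponential_in_closure:
  fixes \<Lambda> :: "real set"
  assumes pos: "\<And>l. l \<in> \<Lambda> \<Longrightarrow> 0 < l" and div: "\<not> inverse summable_on \<Lambda>" and q: "0 \<le> q" and L: "0 \<le> L"
  shows "expo (- q) \<in> uniform_closure {0..L} ((\<lambda>l. expo (- l)) ` \<Lambda>)"
proof (cases "q \<in> \<Lambda>")
  case True
  then show ?thesis
    by (intro subsetD[OF span_subset_uniform_closure] cfun.span_base) auto
next
  case False
  show ?thesis
    unfolding uniform_closure_def
  proof safe
    fix e :: real assume e: "0 < e"
    \<comment> \<open>The factor \<open>(l - q) / (l + s)\<close> may be negative; \<open>s \<ge> 2 * q + 1\<close> keeps its modulus below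
      \<open>1 - (q + 1) / (l + s)\<close> also in that case.\<close>
    define s where "s = 2 * q + 1"
    have s: "0 < s" using q by (simp add: s_def)
    obtain F where F: "finite F" "F \<subseteq> \<Lambda>" "(s * L - ln e) / (q + 1) < (\<Sum>l\<in>F. inverse (l + s))"
      using shifted_sums_unbounded[OF pos div] s by (metis less_imp_le)
    have F0: "0 < l" "l \<noteq> q" if "l \<in> F" for l using that F pos False by auto
    have inj: "inj_on (\<lambda>l. l + s) F" by auto
    obtain a where a: "\<And>t. t \<in> {0..L} \<Longrightarrow>
        \<bar>exp (- (q + s) * t) - (\<Sum>l\<in>(\<lambda>l. l + s) ` F. a l * exp (- l * t))\<bar>
          \<le> (\<Prod>l\<in>(\<lambda>l. l + s) ` F. \<bar>1 - (q + s) / l\<bar>)"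
    proof -
      have "\<exists>a. \<forall>t\<in>{0..L}. \<bar>exp (- (q + s) * t) - (\<Sum>l\<in>(\<lambda>l. l + s) ` F. a l * exp (- l * t))\<bar>
          \<le> (\<Prod>l\<in>(\<lambda>l. l + s) ` F. \<bar>1 - (q + s) / l\<bar>)"
        using F q s by (intro muntz_error_bound) (auto dest: F0 intro: add_pos_pos)
      then show ?thesis using that by blast
    qed
    have factor: "\<bar>1 - (q + s) / (l + s)\<bar> \<le> exp (- (q + 1) * inverse (l + s))" if "l \<in> F" for l
    proof -
      have "\<bar>1 - (q + s) / (l + s)\<bar> \<le> 1 - (q + 1) * inverse (l + s)"
        using F0[OF that] q by (auto simp: s_def divide_simps abs_le_iff)
      also have "\<dots> \<le> exp (- (q + 1) * inverse (l + s))"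
        using exp_ge_add_one_self[of "- (q + 1) * inverse (l + s)"]
        by (simp only: mult_minus_left add_uminus_conv_diff)
      finally show ?thesis .
    qed
    have "(\<Prod>l\<in>F. \<bar>1 - (q + s) / (l + s)\<bar>) \<le> (\<Prod>l\<in>F. exp (- (q + 1) * inverse (l + s)))"
      using factor by (intro prod_mono) auto
    also have "\<dots> = exp (- (q + 1) * (\<Sum>l\<in>F. inverse (l + s)))"
      using F by (simp add: exp_sum sum_distrib_left)
    also have "\<dots> < exp (- (s * L - ln e))"
      using F(3) q by (simp add: field_simps)
    also have "\<dots> = exp (- (s * L)) * e" using e by (simp add: exp_diff exp_minus field_simps)
    finally have prod: "(\<Prod>l\<in>F. \<bar>1 - (q + s) / (l + s)\<bar>) < exp (- (s * L)) * e" .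
    define g where "g t = (\<Sum>l\<in>F. complex_of_real (a (l + s)) * expo (- l) t)" for t
    have "g \<in> cfun.span ((\<lambda>l. expo (- l)) ` \<Lambda>)"
      unfolding g_def using F by (intro span_sum_pointwise cfun.span_base) auto
    moreover have "cmod (expo (- q) t - g t) < e" if t: "t \<in> {0..L}" for t
    proof -
      have shift: "exp (s * t) * exp (- (l + s) * t) = exp (- l * t)" for l
        by (simp add: algebra_simps flip: exp_add)
      have "exp (s * t) * (exp (- (q + s) * t) - (\<Sum>l\<in>F. a (l + s) * exp (- (l + s) * t)))
          = exp (- q * t) - (\<Sum>l\<in>F. a (l + s) * exp (- l * t))"
        unfolding right_diff_distrib sum_distrib_left mult.left_commute[of "exp (s * t)"] shift ..
      then have "expo (- q) t - g t = complex_of_real (exp (s * t) *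
          (exp (- (q + s) * t) - (\<Sum>l\<in>F. a (l + s) * exp (- (l + s) * t))))"
        by (simp only: expo_def g_def of_real_diff of_real_sum of_real_mult)
      then have "cmod (expo (- q) t - g t) = exp (s * t) *
          \<bar>exp (- (q + s) * t) - (\<Sum>l\<in>F. a (l + s) * exp (- (l + s) * t))\<bar>"
        by (simp only: norm_of_real abs_mult abs_exp_cancel)
      also have "\<dots> \<le> exp (s * t) * (\<Prod>l\<in>F. \<bar>1 - (q + s) / (l + s)\<bar>)"
        using a[OF t] unfolding sum.reindex[OF inj] prod.reindex[OF inj] o_def
        by (intro mult_left_mono) auto
      also have "\<dots> < exp (s * t) * (exp (- (s * L)) * e)"
        using prod by simp
      also have "\<dots> = exp (s * (t - L)) * e" by (simp add: algebra_simps flip: exp_add)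
      also have "\<dots> \<le> 1 * e"
        using t s e by (intro mult_right_mono) (auto simp: mult_le_0_iff)
      finally show ?thesis by simp
    qed
    ultimately show "\<exists>g\<in>cfun.span ((\<lambda>l. expo (- l)) ` \<Lambda>). \<forall>t\<in>{0..L}. cmod (expo (- q) t - g t) < e"
      by blast
  qed
qed

text \<open>In the variable \<open>x = exp (s * t)\<close> these exponentials are the powers of \<open>x\<close>, so this is the
  Weierstrass approximation theorem.\<close>

lemma real_continuous_in_closure_exponentials:
  fixes h :: "real \<Rightarrow> real"
  assumes h: "continuous_on {a..b} h" and s: "s \<noteq> 0"
  shows "(\<lambda>t. complex_of_real (h t)) \<in> uniform_closure {a..b} (range (\<lambda>n::nat. expo (s * n)))"
  unfolding uniform_closure_def
proof safe
  fix e :: real assume e: "0 < e"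
  define X where "X = (\<lambda>t. exp (s * t)) ` {a..b}"
  have X: "compact X" unfolding X_def by (intro compact_continuous_image continuous_intros) auto
  have "continuous_on X (\<lambda>x. h (ln x / s))"
    using s by (intro continuous_on_compose2[OF h]) (auto simp: X_def intro!: continuous_intros)
  then obtain g where g: "real_polynomial_function g" "\<And>x. x \<in> X \<Longrightarrow> \<bar>h (ln x / s) - g x\<bar> < e"
    using Stone_Weierstrass_real_polynomial_function[OF X _ e] by metis
  obtain a' n where g_eq: "g = (\<lambda>x. \<Sum>i\<le>(n::nat). a' i * x ^ i)"
    using g(1) by (auto simp: real_polynomial_function_iff_sum)
  show "\<exists>u\<in>cfun.span (range (\<lambda>n::nat. expo (s * n))).
      \<forall>t\<in>{a..b}. cmod (complex_of_real (h t) - u t) < e"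
  proof (intro bexI ballI)
    show "(\<lambda>t. \<Sum>i\<le>n. complex_of_real (a' i) * expo (s * real i) t) \<in> cfun.span (range (\<lambda>n::nat. expo (s * n)))"
      by (intro span_sum_pointwise cfun.span_base) auto
    fix t assume t: "t \<in> {a..b}"
    have "(\<Sum>i\<le>n. complex_of_real (a' i) * expo (s * real i) t) = complex_of_real (g (exp (s * t)))"
      by (simp add: g_eq expo_def mult_ac flip: exp_of_nat_mult)
    then have "cmod (complex_of_real (h t) - (\<Sum>i\<le>n. complex_of_real (a' i) * expo (s * real i) t))
       = \<bar>h (ln (exp (s * t)) / s) - g (exp (s * t))\<bar>"
      using s by (simp flip: of_real_diff)
    also have "\<dots> < e" using t by (intro g(2)) (auto simp: X_def)
    finally show "cmod (complex_of_real (h t) - (\<Sum>i\<le>n. complex_of_real (a' i) * expo (s * real i) t)) < e" .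
  qed
qed

lemma continuous_in_closure_exponentials:
  fixes f :: "real \<Rightarrow> complex"
  assumes f: "continuous_on {a..b} f" and s: "s \<noteq> 0"
  shows "f \<in> uniform_closure {a..b} (range (\<lambda>n::nat. expo (s * n)))" (is "_ \<in> ?C")
proof -
  have re: "(\<lambda>t. complex_of_real (Re (f t))) \<in> ?C" and im: "(\<lambda>t. complex_of_real (Im (f t))) \<in> ?C"
    using f s by (auto intro!: real_continuous_in_closure_exponentials continuous_intros)
  have "(\<lambda>t. complex_of_real (Re (f t))) + (\<lambda>t. \<i> * complex_of_real (Im (f t))) \<in> ?C"
    by (intro cfun.subspace_add[OF uniform_closure_subspace] cfun.subspace_scale[OF uniform_closure_subspace] re im)
  also have "(\<lambda>t. complex_of_real (Re (f t))) + (\<lambda>t. \<i> * complex_of_real (Im (f t))) = f"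
    by (auto simp: fun_eq_iff complex_eq_iff)
  finally show ?thesis .
qed

text \<open>The sign \<open>s\<close> is that of the exponents. Measuring \<open>t\<close> from the endpoint where \<open>exp (s * l * t)\<close> is
  largest turns it into a multiple of a decaying exponential on \<open>[0, b - a]\<close>.\<close>

lemma continuous_in_closure_divergent_exponents:
  fixes \<Lambda> :: "real set" and f :: "real \<Rightarrow> complex"
  assumes pos: "\<And>l. l \<in> \<Lambda> \<Longrightarrow> 0 < l" and div: "\<not> inverse summable_on \<Lambda>"
    and s: "s = 1 \<or> s = - 1" and f: "continuous_on {a..b} f" and ab: "a \<le> b"
  shows "f \<in> uniform_closure {a..b} ((\<lambda>l. expo (s * l)) ` \<Lambda>)" (is "_ \<in> ?C")
proof -
  define t0 where "t0 = (if s = 1 then b else a)"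
  have "expo (s * real n) \<in> ?C" for n :: nat
  proof -
    have "(\<lambda>t. 1 * expo (- real n) (- s * (t - t0))) \<in> ?C"
    proof (rule uniform_closure_transform)
      show "expo (- real n) \<in> uniform_closure {0..b - a} ((\<lambda>l. expo (- l)) ` \<Lambda>)"
        using pos div ab by (intro decaying_exponential_in_closure) auto
      show "- s * (t - t0) \<in> {0..b - a}" if "t \<in> {a..b}" for t
        using s that by (auto simp: t0_def)
      show "cmod 1 \<le> 1" by simp
      fix g assume "g \<in> (\<lambda>l. expo (- l)) ` \<Lambda>"
      then obtain l where l: "l \<in> \<Lambda>" "g = expo (- l)" by auto
      have "(\<lambda>t. complex_of_real (exp (- l * s * t0)) * expo (s * l) t) \<in> cfun.span ((\<lambda>l. expo (s * l)) ` \<Lambda>)"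
        using l by (intro cfun.span_scale cfun.span_base) auto
      also have "(\<lambda>t. complex_of_real (exp (- l * s * t0)) * expo (s * l) t) = (\<lambda>t. 1 * g (- s * (t - t0)))"
        unfolding l(2) expo_def by (simp add: algebra_simps flip: exp_add of_real_mult)
      finally show "(\<lambda>t. 1 * g (- s * (t - t0))) \<in> cfun.span ((\<lambda>l. expo (s * l)) ` \<Lambda>)" .
    qed
    then have "(\<lambda>t. complex_of_real (exp (n * s * t0)) * (1 * expo (- real n) (- s * (t - t0)))) \<in> ?C"
      by (rule cfun.subspace_scale[OF uniform_closure_subspace])
    also have "(\<lambda>t. complex_of_real (exp (n * s * t0)) * (1 * expo (- real n) (- s * (t - t0)))) = expo (s * n)"
      unfolding expo_def by (simp add: fun_eq_iff algebra_simps flip: exp_add of_real_mult)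
    finally show ?thesis .
  qed
  then show ?thesis
    using s by (intro uniform_closure_trans[OF _ continuous_in_closure_exponentials[OF f, of s]]) auto
qed

text \<open>Positive and negative centres are separated; if both parts had summable reciprocals, so would
  \<open>\<Omega>\<close>. A part with divergent sum suffices by itself.\<close>

lemma continuous_in_closure_gaussians:
  fixes f :: "real \<Rightarrow> complex"
  assumes div: "\<not> (\<lambda>\<omega>. inverse \<bar>\<omega>\<bar>) summable_on (\<Omega> - {0})"
    and f: "continuous_on {a..b} f" and ab: "a \<le> b" and c: "0 < c"
  shows "f \<in> uniform_closure {a..b} (gaussian_translates c \<Omega>)"
proof -
  define H where "H s = {l. 0 < l \<and> s * l \<in> \<Omega>}" for s :: real
  have H: "(\<lambda>\<omega>. inverse \<bar>\<omega>\<bar>) summable_on (\<lambda>l. s * l) ` H s" if "s = 1 \<or> s = -1" "inverse summable_on H s" for s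
  proof (subst summable_on_reindex)
    show "inj_on (\<lambda>l. s * l) (H s)" using that by (auto simp: inj_on_def)
    have "(\<lambda>\<omega>. inverse \<bar>\<omega>\<bar>) \<circ> (*) s summable_on H s \<longleftrightarrow> inverse summable_on H s"
      using that(1) by (intro summable_on_cong) (auto simp: H_def)
    with that show "(\<lambda>\<omega>. inverse \<bar>\<omega>\<bar>) \<circ> (*) s summable_on H s" by blast
  qed
  have "\<Omega> - {0} = (\<lambda>l. 1 * l) ` H 1 \<union> (\<lambda>l. - 1 * l) ` H (- 1)"
  proof -
    have "\<omega> \<in> (\<lambda>l. - 1 * l) ` H (- 1)" if "\<omega> \<in> \<Omega>" "\<omega> < 0" for \<omega>
      using that by (intro image_eqI[of _ _ "- \<omega>"]) (auto simp: H_def)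
    then show ?thesis by (fastforce simp: H_def)
  qed
  moreover have "(\<lambda>l. 1 * l) ` H 1 \<inter> (\<lambda>l. - 1 * l) ` H (- 1) = {}"
    by (auto simp: H_def)
  ultimately have "\<not> (inverse summable_on H 1 \<and> inverse summable_on H (- 1))"
    using div H[of 1] H[of "- 1"] by (metis summable_on_Un_disjoint)
  then obtain s where s: "s = 1 \<or> s = - 1" "\<not> inverse summable_on H s" by blast
  define \<Lambda> where "\<Lambda> = (\<lambda>l. 2 * c * l) ` H s"
  have "\<not> inverse summable_on \<Lambda>"
  proof
    assume "inverse summable_on \<Lambda>"
    then have "(inverse \<circ> (\<lambda>l. 2 * c * l)) summable_on H s"
      unfolding \<Lambda>_def by (subst (asm) summable_on_reindex) (use c in \<open>auto simp: inj_on_def\<close>)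
    then have "(\<lambda>l. (2 * c) * (inverse \<circ> (\<lambda>l. 2 * c * l)) l) summable_on H s"
      by (rule summable_on_cmult_right)
    also have "(\<lambda>l. (2 * c) * (inverse \<circ> (\<lambda>l. 2 * c * l)) l) = inverse"
      using c by (auto simp: fun_eq_iff)
    finally show False using s by blast
  qed
  moreover have "0 < l" if "l \<in> \<Lambda>" for l using that c by (auto simp: \<Lambda>_def H_def)
  moreover have "continuous_on {a..b} (\<lambda>t. complex_of_real (exp (c * t\<^sup>2)) * f t)"
    using f by (auto intro!: continuous_intros)
  ultimately have in_closure: "(\<lambda>t. complex_of_real (exp (c * t\<^sup>2)) * f t) \<in> uniform_closure {a..b} ((\<lambda>l. expo (s * l)) ` \<Lambda>)"
    using s ab by (intro continuous_in_closure_divergent_exponents) auto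
  have "(\<lambda>t. complex_of_real (exp (- c * t\<^sup>2)) * (complex_of_real (exp (c * t\<^sup>2)) * f t))
      \<in> uniform_closure {a..b} (gaussian_translates c \<Omega>)"
  proof (rule uniform_closure_transform[OF in_closure, where \<phi> = "\<lambda>t. t" and B = 1])
    show "cmod (complex_of_real (exp (- c * t\<^sup>2))) \<le> 1" for t using c by simp
    fix g assume "g \<in> (\<lambda>l. expo (s * l)) ` \<Lambda>"
    then obtain \<omega> where \<omega>: "\<omega> \<in> \<Omega>" "g = expo (2 * c * \<omega>)"
      by (auto simp: \<Lambda>_def H_def mult_ac)
    have "(\<lambda>t. complex_of_real (exp (c * \<omega>\<^sup>2)) * complex_of_real (exp (- c * (t - \<omega>)\<^sup>2))) \<in> cfun.span (gaussian_translates c \<Omega>)"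
      using \<omega> by (intro cfun.span_scale cfun.span_base) (auto simp: gaussian_translates_def)
    also have "(\<lambda>t. complex_of_real (exp (c * \<omega>\<^sup>2)) * complex_of_real (exp (- c * (t - \<omega>)\<^sup>2))) =
        (\<lambda>t. complex_of_real (exp (- c * t\<^sup>2)) * g t)"
      unfolding \<omega>(2) expo_def
      by (simp add: fun_eq_iff algebra_simps power2_eq_square flip: exp_add of_real_mult)
    finally show "(\<lambda>t. complex_of_real (exp (- c * t\<^sup>2)) * g t) \<in> cfun.span (gaussian_translates c \<Omega>)" .
  qed auto
  also have "(\<lambda>t. complex_of_real (exp (- c * t\<^sup>2)) * (complex_of_real (exp (c * t\<^sup>2)) * f t)) = f"
    by (simp add: fun_eq_iff mult.assoc[symmetric] flip: exp_add of_real_mult)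
  finally show ?thesis .
qed


section \<open>Difference operators that annihilate an exponential\<close>

lemma integrable_mult_of_squares:
  fixes f g :: "real \<Rightarrow> real"
  assumes [measurable]: "f \<in> borel_measurable borel" "g \<in> borel_measurable borel"
    and "integrable lborel (\<lambda>t. (f t)\<^sup>2)" "integrable lborel (\<lambda>t. (g t)\<^sup>2)"
  shows "integrable lborel (\<lambda>t. f t * g t)"
proof (rule Bochner_Integration.integrable_bound)
  show "integrable lborel (\<lambda>t. (f t)\<^sup>2 + (g t)\<^sup>2)" using assms by simp
  have "\<bar>x * y\<bar> \<le> x\<^sup>2 + y\<^sup>2" for x y :: real
    using sum_squares_bound[of x y] sum_squares_bound[of x "- y"] by (auto simp: abs_le_iff) 
  then show "AE t in lborel. norm (f t * g t) \<le> norm ((f t)\<^sup>2 + (g t)\<^sup>2)" by simp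
qed simp

lemma integrable_square_translate:
  fixes f :: "real \<Rightarrow> real"
  assumes "integrable lborel (\<lambda>t. (f t)\<^sup>2)"
  shows "integrable lborel (\<lambda>t. (f (t + x))\<^sup>2)"
  using lborel_integrable_real_affine[OF assms, of 1 x] by (simp add: add.commute)

text \<open>With \<open>M\<close> the mean and \<open>D\<close> half the difference of the values at \<open>t + d\<close> and \<open>t - d\<close>, this is
  \<open>M - \<kappa> * (D M)\<close>; on \<open>exp (l * t)\<close> it acts as multiplication by
  \<open>cosh (d * l) * (1 - \<kappa> * sinh (d * l))\<close>, which is zero for \<open>\<kappa> = 1 / sinh (d * l)\<close>.\<close>

definition annihilator :: "real \<Rightarrow> real \<Rightarrow> (real \<Rightarrow> real) \<Rightarrow> real \<Rightarrow> real" where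
  "annihilator d \<kappa> f t = (f (t + d) + f (t - d)) / 2 - \<kappa> * (f (t + 2 * d) - f (t - 2 * d)) / 4"

text \<open>All inner products of translates of \<open>f\<close> are values of its autocorrelation \<open>R\<close>, which is even.
  The mean and the difference part are therefore orthogonal, and the squared norm equals
  \<open>(R 0 + R (2 * d)) / 2 + \<kappa>\<^sup>2 * (R 0 - R (4 * d)) / 8\<close>. A translation by \<open>4 * d\<close> moves \<open>f\<close> at most twice
  as far as a translation by \<open>2 * d\<close>, so \<open>R 0 - R (4 * d) \<le> 4 * (R 0 - R (2 * d))\<close>, and for \<open>\<bar>\<kappa>\<bar> \<le> 1\<close>
  what the second term adds is at most what the first has lost compared with \<open>R 0\<close>.\<close>

lemma annihilator_L2_bound:
  fixes f :: "real \<Rightarrow> real"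
  assumes meas: "f \<in> borel_measurable borel" and sq: "integrable lborel (\<lambda>t. (f t)\<^sup>2)"
  shows "annihilator d \<kappa> f \<in> borel_measurable borel" (is ?meas)
    and "integrable lborel (\<lambda>t. (annihilator d \<kappa> f t)\<^sup>2)" (is ?sq)
    and "(\<integral>t. (annihilator d \<kappa> f t)\<^sup>2 \<partial>lborel) \<le> max 1 (\<kappa>\<^sup>2) * (\<integral>t. (f t)\<^sup>2 \<partial>lborel)" (is ?bound)
proof -
  note [measurable] = meas
  define X where "X i t = f (t + i * d)" for i t :: real
  define R where "R h = (\<integral>t. f t * f (t + h) \<partial>lborel)" for h
  have Xm [measurable]: "X i \<in> borel_measurable borel" for i unfolding X_def by measurable
  have Xsq: "integrable lborel (\<lambda>t. (X i t)\<^sup>2)" for i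
    unfolding X_def using sq by (rule integrable_square_translate)
  have XX: "integrable lborel (\<lambda>t. X i t * X j t)" for i j
    by (intro integrable_mult_of_squares Xm Xsq)
  have corr: "(\<integral>t. X i t * X j t \<partial>lborel) = R ((j - i) * d)" for i j
    unfolding R_def
    by (subst lborel_integral_real_affine[of 1 _ "i * d"]) (auto simp: X_def algebra_simps)
  have R_even: "R (- h) = R h" for h
    unfolding R_def
    by (subst lborel_integral_real_affine[of 1 _ h]) (auto simp: algebra_simps)
  define r0 r2 r4 where "r0 = R 0" "r2 = R (2 * d)" "r4 = R (4 * d)"
  have lin2: "(\<integral>t. (\<alpha> * X i t + \<beta> * X j t)\<^sup>2 \<partial>lborel) = (\<alpha>\<^sup>2 + \<beta>\<^sup>2) * r0 + 2 * \<alpha> * \<beta> * R ((j - i) * d)" for \<alpha> \<beta> i j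
  proof -
    have "(\<integral>t. (\<alpha> * X i t + \<beta> * X j t)\<^sup>2 \<partial>lborel) = (\<integral>t. \<alpha>\<^sup>2 * (X i t * X i t) + \<beta>\<^sup>2 * (X j t * X j t) + 2 * \<alpha> * \<beta> * (X i t * X j t) \<partial>lborel)"
      by (intro Bochner_Integration.integral_cong) (auto simp: power2_eq_square algebra_simps)
    then show ?thesis by (simp add: XX corr) (simp add: r0_r2_r4_def algebra_simps)
  qed
  have int2: "integrable lborel (\<lambda>t. (\<alpha> * X i t + \<beta> * X j t)\<^sup>2)" for \<alpha> \<beta> i j
  proof -
    have "(\<lambda>t. (\<alpha> * X i t + \<beta> * X j t)\<^sup>2) = (\<lambda>t. \<alpha>\<^sup>2 * (X i t * X i t) + \<beta>\<^sup>2 * (X j t * X j t) + 2 * \<alpha> * \<beta> * (X i t * X j t))"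
      by (auto simp: fun_eq_iff power2_eq_square algebra_simps)
    then show ?thesis by (simp add: XX)
  qed
  have nonneg: "0 \<le> (\<alpha>\<^sup>2 + \<beta>\<^sup>2) * r0 + 2 * \<alpha> * \<beta> * R ((j - i) * d)" for \<alpha> \<beta> i j
    unfolding lin2[symmetric] by simp
  have r2: "r2 \<le> r0" "- r2 \<le> r0"
    using nonneg[of 1 "- 1" 2 0] nonneg[of 1 1 2 0] by (auto simp: r0_r2_r4_def)
  have r4: "r0 - r4 \<le> 4 * (r0 - r2)"
  proof -
    have "(\<integral>t. (1 * X 2 t + (- 1) * X (-2) t)\<^sup>2 \<partial>lborel) \<le>
        (\<integral>t. 2 * (1 * X 2 t + (- 1) * X 0 t)\<^sup>2 + 2 * (1 * X 0 t + (- 1) * X (-2) t)\<^sup>2 \<partial>lborel)"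
    proof (rule integral_mono)
      show "(1 * X 2 t + - 1 * X (- 2) t)\<^sup>2 \<le> 2 * (1 * X 2 t + - 1 * X 0 t)\<^sup>2 + 2 * (1 * X 0 t + - 1 * X (- 2) t)\<^sup>2" for t
        using zero_le_power2[of "X 2 t - 2 * X 0 t + X (-2) t"]
        by (simp add: power2_eq_square algebra_simps)
    qed (intro Bochner_Integration.integrable_add integrable_mult_right int2)+
    also have "\<dots> = 2 * (\<integral>t. (1 * X 2 t + (- 1) * X 0 t)\<^sup>2 \<partial>lborel) + 2 * (\<integral>t. (1 * X 0 t + (- 1) * X (-2) t)\<^sup>2 \<partial>lborel)"
      by (subst Bochner_Integration.integral_add) (intro integrable_mult_right int2 | simp)+
    finally show ?thesis
      unfolding lin2 using R_even[of "2 * d"] R_even[of "4 * d"] by (simp add: r0_r2_r4_def)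
  qed
  have T: "annihilator d \<kappa> f t = (X 1 t + X (- 1) t) / 2 - \<kappa> * (X 2 t - X (- 2) t) / 4" for t
    by (simp add: annihilator_def X_def)
  show ?meas unfolding T[abs_def] by measurable
  have expand: "(annihilator d \<kappa> f t)\<^sup>2 = (1 / 4) * (1 * X 1 t + 1 * X (-1) t)\<^sup>2 + (\<kappa>\<^sup>2 / 16) * (1 * X 2 t + (- 1) * X (-2) t)\<^sup>2
      - (\<kappa> / 4) * (X 1 t * X 2 t + X (-1) t * X 2 t - X 1 t * X (-2) t - X (-1) t * X (-2) t)" for t
    unfolding T by (simp add: power2_eq_square field_simps)
  have int: "integrable lborel (\<lambda>t. (1 * X 1 t + 1 * X (-1) t)\<^sup>2)" "integrable lborel (\<lambda>t. (1 * X 2 t + (- 1) * X (-2) t)\<^sup>2)"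
    by (rule int2)+
  show ?sq unfolding expand using int by (simp add: XX)
  have "(\<integral>t. (annihilator d \<kappa> f t)\<^sup>2 \<partial>lborel) = (1 / 4) * (2 * r0 + 2 * r2) + (\<kappa>\<^sup>2 / 16) * (2 * r0 - 2 * r4)
     - (\<kappa> / 4) * (R d + R (3 * d) - R (3 * d) - R d)"
  proof -
    have "(\<integral>t. (annihilator d \<kappa> f t)\<^sup>2 \<partial>lborel) = (1 / 4) * (\<integral>t. (1 * X 1 t + 1 * X (-1) t)\<^sup>2 \<partial>lborel) + (\<kappa>\<^sup>2 / 16) * (\<integral>t. (1 * X 2 t + (- 1) * X (-2) t)\<^sup>2 \<partial>lborel)
      - (\<kappa> / 4) * (R d + R (3 * d) - R (- (3 * d)) - R (- d))"
      unfolding expand using int by (simp add: XX corr)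
    then show ?thesis unfolding lin2 using R_even[of "2 * d"] R_even[of "4 * d"]
      by (simp add: R_even r0_r2_r4_def)
  qed
  also have "\<dots> = (r0 + r2) / 2 + \<kappa>\<^sup>2 * (r0 - r4) / 8" by (simp add: field_simps)
  also have "\<dots> \<le> (r0 + r2) / 2 + \<kappa>\<^sup>2 * (4 * (r0 - r2)) / 8"
    using r4 by (intro add_left_mono divide_right_mono mult_left_mono) auto
  also have "\<dots> \<le> max 1 (\<kappa>\<^sup>2) * (r0 + r2) / 2 + max 1 (\<kappa>\<^sup>2) * (4 * (r0 - r2)) / 8"
    using r2 mult_right_mono[of 1 "max 1 (\<kappa>\<^sup>2)" "r0 + r2"] by (intro add_mono divide_right_mono mult_right_mono) auto
  also have "\<dots> = max 1 (\<kappa>\<^sup>2) * r0" by (simp add: field_simps)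
  also have "r0 = (\<integral>t. (f t)\<^sup>2 \<partial>lborel)" by (simp add: r0_r2_r4_def R_def power2_eq_square)
  finally show ?bound .
qed

lemma annihilator_exponential_sum:
  fixes f :: "real \<Rightarrow> real"
  assumes S: "finite S" "m \<notin> S" and m: "m \<noteq> 0" and d: "0 < d"
    and f: "\<And>t. t \<in> {x..y} \<Longrightarrow> f t = k - (\<Sum>l\<in>insert m S. a l * exp (l * t))"
  shows "\<exists>a'. \<forall>t\<in>{x + 2 * d..y - 2 * d}.
    annihilator d (1 / sinh (d * m)) f t = k - (\<Sum>l\<in>S. a' l * exp (l * t))"
proof -
  define \<kappa> where "\<kappa> = 1 / sinh (d * m)"
  define \<sigma> where "\<sigma> l = cosh (d * l) - \<kappa> * sinh (2 * (d * l)) / 2" for l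
  have "\<sigma> m = 0" using m d by (simp add: \<sigma>_def \<kappa>_def sinh_double)
  have e: "annihilator d \<kappa> (\<lambda>t. exp (l * t)) t = \<sigma> l * exp (l * t)" for l t
    by (simp add: annihilator_def \<sigma>_def cosh_def sinh_def field_simps flip: exp_add)
  have "annihilator d (1 / sinh (d * m)) f t = k - (\<Sum>l\<in>S. (a l * \<sigma> l) * exp (l * t))"
    if t: "t \<in> {x + 2 * d..y - 2 * d}" for t
  proof -
    let ?P = "\<lambda>t. \<Sum>l\<in>insert m S. a l * exp (l * t)"
    have "annihilator d \<kappa> f t = annihilator d \<kappa> (\<lambda>t. k - ?P t) t"
      unfolding annihilator_def using t d by (subst (1 2 3 4) f) auto
    also have "\<dots> = k - annihilator d \<kappa> ?P t"
      by (simp add: annihilator_def field_simps)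
    also have "annihilator d \<kappa> ?P t = (\<Sum>l\<in>insert m S. a l * annihilator d \<kappa> (\<lambda>t. exp (l * t)) t)"
      unfolding annihilator_def
      by (simp only: sum_distrib_left sum_divide_distrib sum.distrib[symmetric] sum_subtractf[symmetric])
         (intro sum.cong refl, simp add: field_simps)
    also have "\<dots> = (\<Sum>l\<in>S. (a l * \<sigma> l) * exp (l * t))"
      using S \<open>\<sigma> m = 0\<close> by (simp add: e mult.assoc)
    finally show "annihilator d (1 / sinh (d * m)) f t = k - (\<Sum>l\<in>S. (a l * \<sigma> l) * exp (l * t))"
      unfolding \<kappa>_def .
  qed
  then show ?thesis by (intro exI[of _ "\<lambda>l. a l * \<sigma> l"]) blast
qed

text \<open>The annihilators are applied one frequency at a time. Each keeps the constant \<open>k\<close>, removes one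
  exponential, shortens the interval by \<open>4 * d l\<close> in total and multiplies the squared norm by at
  most the factor in the product; in the end \<open>f\<close> equals \<open>k\<close> on what remains of the interval. Outside
  \<open>[x,y]\<close> the function is arbitrary, so it may be cut off to zero.\<close>

lemma constant_term_L2_bound:
  fixes f :: "real \<Rightarrow> real"
  assumes "finite S" "\<And>l. l \<in> S \<Longrightarrow> l \<noteq> 0" "\<And>l. l \<in> S \<Longrightarrow> 0 < d l"
    and "f \<in> borel_measurable borel" "integrable lborel (\<lambda>t. (f t)\<^sup>2)"
    and "\<And>t. t \<in> {x..y} \<Longrightarrow> f t = k - (\<Sum>l\<in>S. a l * exp (l * t))"
  shows "(y - x - 4 * (\<Sum>l\<in>S. d l)) * k\<^sup>2 \<le>
    (\<Prod>l\<in>S. max 1 ((1 / sinh (d l * l))\<^sup>2)) * (\<integral>t. (f t)\<^sup>2 \<partial>lborel)"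
  using assms
proof (induction S arbitrary: f a x y rule: finite_induct)
  case empty
  show ?case
  proof (cases "x \<le> y")
    case True
    have "(y - x) * k\<^sup>2 = (\<integral>t. indicator {x..y} t * k\<^sup>2 \<partial>lborel)"
      using True by simp
    also have "\<dots> \<le> (\<integral>t. (f t)\<^sup>2 \<partial>lborel)"
    proof (rule integral_mono)
      show "integrable lborel (\<lambda>t. indicator {x..y} t * k\<^sup>2)" using True by (simp add: emeasure_lborel_Icc_eq)
    qed (use empty in \<open>auto simp: indicator_def\<close>)
    finally show ?thesis by simp
  next
    case False
    then have "(y - x) * k\<^sup>2 \<le> 0" by (intro mult_nonpos_nonneg) auto
    also have "0 \<le> (\<integral>t. (f t)\<^sup>2 \<partial>lborel)" by simp
    finally show ?thesis by simp
  qed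
next
  case (insert m S)
  have m: "m \<noteq> 0" "0 < d m" using insert by auto
  obtain a' where a': "\<And>t. t \<in> {x + 2 * d m..y - 2 * d m} \<Longrightarrow>
    annihilator (d m) (1 / sinh (d m * m)) f t = k - (\<Sum>l\<in>S. a' l * exp (l * t))"
    using annihilator_exponential_sum[where f=f and k=k, OF insert.hyps m insert.prems(5)] by blast
  let ?T = "annihilator (d m) (1 / sinh (d m * m)) f"
  note T = annihilator_L2_bound[OF insert.prems(3,4), of "d m" "1 / sinh (d m * m)"]
  have "(y - x - 4 * (\<Sum>l\<in>insert m S. d l)) * k\<^sup>2 =
      ((y - 2 * d m) - (x + 2 * d m) - 4 * (\<Sum>l\<in>S. d l)) * k\<^sup>2"
    using insert.hyps by simp
  also have "\<dots> \<le> (\<Prod>l\<in>S. max 1 ((1 / sinh (d l * l))\<^sup>2)) * (\<integral>t. (?T t)\<^sup>2 \<partial>lborel)"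
    by (rule insert.IH[OF _ _ T(1,2) a']) (use insert.prems in auto)
  also have "\<dots> \<le> (\<Prod>l\<in>S. max 1 ((1 / sinh (d l * l))\<^sup>2)) *
      (max 1 ((1 / sinh (d m * m))\<^sup>2) * (\<integral>t. (f t)\<^sup>2 \<partial>lborel))"
    by (intro mult_left_mono T(3) prod_nonneg) auto
  also have "\<dots> = (\<Prod>l\<in>insert m S. max 1 ((1 / sinh (d l * l))\<^sup>2)) * (\<integral>t. (f t)\<^sup>2 \<partial>lborel)"
    using insert.hyps by simp
  finally show ?case .
qed

text \<open>The step \<open>d = 1 / \<bar>l\<bar>\<close> makes the annihilator of \<open>exp (l * t)\<close> an \<open>L\<^sup>2\<close> contraction.\<close>

lemma inverse_sinh_unit_square_le_one:
  fixes x :: real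
  assumes "\<bar>x\<bar> = 1"
  shows "(1 / sinh x)\<^sup>2 \<le> 1"
proof -
  have e: "5 / 2 \<le> exp (1 :: real)" using exp_lower_Taylor_quadratic[of "1 :: real"] by simp
  have "exp (- 1 :: real) \<le> 2 / 5"
    using le_imp_inverse_le[OF e] by (simp add: exp_minus)
  then have "1 \<le> sinh (1 :: real)" using e by (simp add: sinh_def)
  then have "1 \<le> (sinh 1 :: real)\<^sup>2" by (simp add: one_le_power)
  moreover have "(sinh x)\<^sup>2 = (sinh 1 :: real)\<^sup>2"
    using assms by (cases "x = 1") (auto simp: abs_if split: if_splits)
  ultimately show ?thesis by (simp add: power_divide divide_simps)
qed

section \<open>Separation when the reciprocals converge\<close>

lemma summable_on_small_tail:
  fixes f :: "'a \<Rightarrow> real"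
  assumes f: "f summable_on A" "\<And>x. x \<in> A \<Longrightarrow> 0 \<le> f x" and e: "0 < e"
  obtains A0 where "finite A0" "A0 \<subseteq> A" "\<And>F. finite F \<Longrightarrow> F \<subseteq> A - A0 \<Longrightarrow> sum f F \<le> e"
proof -
  obtain A0 where A0: "finite A0" "A0 \<subseteq> A" "dist (sum f A0) (infsum f A) \<le> e"
    using infsum_finite_approximation[OF f(1) e] by auto
  have "sum f F \<le> e" if F: "finite F" "F \<subseteq> A - A0" for F
  proof -
    have "sum f (A0 \<union> F) \<le> infsum f A"
      using f A0 F by (intro finite_sum_le_infsum) auto
    moreover have "sum f (A0 \<union> F) = sum f A0 + sum f F"
      using A0 F by (intro sum.union_disjoint) auto
    ultimately show ?thesis using A0(3) by (auto simp: dist_real_def)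
  qed
  with A0 that show ?thesis by blast
qed


text \<open>The left-hand side is the integral of \<open>1 - (\<Sum>l\<in>F. c l * exp (l * t))\<close> over the window of radius \<open>\<eta>\<close>
  around \<open>t\<close>. It has again the form of a constant minus an exponential sum with the same
  frequencies, but is bounded pointwise by the \<open>L\<^sup>1\<close> norm.\<close>

lemma window_average_bound:
  fixes \<eta> :: real
  assumes F: "finite F" "0 \<notin> F" and \<eta>: "0 < \<eta>" and t: "t \<in> {a + \<eta>..b - \<eta>}"
  shows "\<bar>2 * \<eta> - (\<Sum>l\<in>F. (c l * (2 * sinh (\<eta> * l)) / l) * exp (l * t))\<bar>
    \<le> integral {a..b} (\<lambda>t. \<bar>1 - (\<Sum>l\<in>F. c l * exp (l * t))\<bar>)"
proof -
  let ?h = "\<lambda>t. 1 - (\<Sum>l\<in>F. c l * exp (l * t))"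
  have cont: "continuous_on A ?h" for A by (intro continuous_intros)
  let ?H = "\<lambda>t. t - (\<Sum>l\<in>F. c l * exp (l * t) / l)"
  have der: "(?H has_real_derivative ?h u) (at u within A)" for u A
  proof -
    have "l \<noteq> 0" if "l \<in> F" for l using that F by metis
    then show ?thesis by (auto intro!: derivative_eq_intros sum.cong)
  qed
  have "(?h has_integral (?H (t + \<eta>) - ?H (t - \<eta>))) {t - \<eta>..t + \<eta>}"
    using \<eta> by (intro fundamental_theorem_of_calculus der[unfolded has_real_derivative_iff_has_vector_derivative]) auto
  moreover have "?H (t + \<eta>) - ?H (t - \<eta>) = 2 * \<eta> - (\<Sum>l\<in>F. (c l * (2 * sinh (\<eta> * l)) / l) * exp (l * t))"
  proof -
    have "c l * exp (l * (t + \<eta>)) / l - c l * exp (l * (t - \<eta>)) / l = (c l * (2 * sinh (\<eta> * l)) / l) * exp (l * t)" for l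
    proof -
      have e: "exp (l * (t + \<eta>)) = exp (\<eta> * l) * exp (l * t)" "exp (l * (t - \<eta>)) = exp (- (\<eta> * l)) * exp (l * t)"
        by (simp_all add: algebra_simps flip: exp_add)
      have "k * (x * z) / l - k * (y * z) / l = (k * (2 * ((x - y) / 2)) / l) * z" for k x y z :: real
        by (simp add: left_diff_distrib right_diff_distrib diff_divide_distrib)
      then show ?thesis unfolding e sinh_field_def .
    qed
    then have "(\<Sum>l\<in>F. c l * exp (l * (t + \<eta>)) / l) - (\<Sum>l\<in>F. c l * exp (l * (t - \<eta>)) / l)
        = (\<Sum>l\<in>F. (c l * (2 * sinh (\<eta> * l)) / l) * exp (l * t))"
      by (simp only: sum_subtractf[symmetric])
    then show ?thesis by linarith
  qed
  ultimately have "2 * \<eta> - (\<Sum>l\<in>F. (c l * (2 * sinh (\<eta> * l)) / l) * exp (l * t)) = integral {t - \<eta>..t + \<eta>} ?h"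
    by (simp only: integral_unique)
  also have "\<bar>\<dots>\<bar> \<le> integral {t - \<eta>..t + \<eta>} (\<lambda>t. \<bar>?h t\<bar>)"
    using integral_norm_bound_integral[of ?h "{t - \<eta>..t + \<eta>}" "\<lambda>t. \<bar>?h t\<bar>"] cont
    by (simp add: integrable_continuous_interval continuous_intros)
  also have "\<dots> \<le> integral {a..b} (\<lambda>t. \<bar>?h t\<bar>)"
    using t cont by (intro integral_subset_le integrable_continuous_interval continuous_intros) auto
  finally show ?thesis .
qed

text \<open>The constants are chosen so that \<open>\<Lambda>0\<close> and its complement each use up steps of total length at most
  \<open>L / 32\<close>. The annihilators then shorten the window-averaged function's interval, of length
  \<open>L / 2\<close>, by at most \<open>L / 4\<close>, and only the frequencies in \<open>\<Lambda>0\<close> contribute to the constant \<open>C\<close>,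
  which is thus the same for all exponential sums.\<close>

lemma exponential_sums_away_from_one:
  fixes \<Lambda> :: "real set"
  assumes sum: "(\<lambda>l. inverse \<bar>l\<bar>) summable_on \<Lambda>" and "0 \<notin> \<Lambda>" and ab: "a < b"
  shows "\<exists>\<kappa>>0. \<forall>F c. finite F \<longrightarrow> F \<subseteq> \<Lambda> \<longrightarrow>
    \<kappa> \<le> integral {a..b} (\<lambda>t. \<bar>1 - (\<Sum>l\<in>F. c l * exp (l * t))\<bar>)"
proof -
  define L where "L = b - a"
  have L: "0 < L" using ab by (simp add: L_def)
  obtain \<Lambda>0 where \<Lambda>0: "finite \<Lambda>0" "\<Lambda>0 \<subseteq> \<Lambda>"
    and tail: "\<And>F. finite F \<Longrightarrow> F \<subseteq> \<Lambda> - \<Lambda>0 \<Longrightarrow> (\<Sum>l\<in>F. inverse \<bar>l\<bar>) \<le> L / 32"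
    using summable_on_small_tail[OF sum, of "L / 32"] L by auto
  define d where "d l = (if l \<in> \<Lambda>0 then L / 32 / (card \<Lambda>0 + 1) else inverse \<bar>l\<bar>)" for l
  define M where "M l = max 1 ((1 / sinh (d l * l))\<^sup>2)" for l
  define C where "C = (\<Prod>l\<in>\<Lambda>0. M l)"
  have C: "1 \<le> C" unfolding C_def M_def by (intro prod_ge_1) auto
  define \<kappa> where "\<kappa> = sqrt (L\<^sup>2 / (16 * C))"
  have "\<kappa> \<le> integral {a..b} (\<lambda>t. \<bar>1 - (\<Sum>l\<in>F. c l * exp (l * t))\<bar>)"
    if F: "finite F" "F \<subseteq> \<Lambda>" for F c
  proof -
    define I where "I = integral {a..b} (\<lambda>t. \<bar>1 - (\<Sum>l\<in>F. c l * exp (l * t))\<bar>)"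
    have I: "0 \<le> I" unfolding I_def by (intro integral_nonneg integrable_continuous_interval continuous_intros) auto
    define \<eta> where "\<eta> = L / 4"
    have \<eta>: "0 < \<eta>" using L by (simp add: \<eta>_def)
    \<comment> \<open>The window average of the difference between one and the exponential sum, cut off to the
      points whose window stays inside \<open>[a,b]\<close>.\<close>
    define \<phi> where "\<phi> t = 2 * \<eta> - (\<Sum>l\<in>F. (c l * (2 * sinh (\<eta> * l)) / l) * exp (l * t))" for t
    define f where "f t = indicator {a + \<eta>..b - \<eta>} t * \<phi> t" for t
    have \<phi>_meas: "\<phi> \<in> borel_measurable borel"
      unfolding \<phi>_def by (intro borel_measurable_continuous_onI continuous_intros)
    then have f_meas: "f \<in> borel_measurable borel" unfolding f_def by measurable
    have F0: "0 \<notin> F" using F assms by auto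
    have f_le: "(f t)\<^sup>2 \<le> indicator {a..b} t * I\<^sup>2" for t
    proof (cases "t \<in> {a + \<eta>..b - \<eta>}")
      case True
      then have "\<bar>\<phi> t\<bar> \<le> \<bar>I\<bar>"
        using window_average_bound[OF F(1) F0 \<eta> True, of c] I by (simp add: \<phi>_def I_def)
      then show ?thesis using True \<eta> by (auto simp: f_def indicator_def abs_le_square_iff)
    qed (simp add: f_def)
    have ind: "integrable lborel (\<lambda>t. indicator {a..b} t * I\<^sup>2)"
      by (simp add: emeasure_lborel_Icc_eq)
    have f_sq: "integrable lborel (\<lambda>t. (f t)\<^sup>2)"
      using f_meas f_le by (intro Bochner_Integration.integrable_bound[OF ind]) auto
    have "(\<integral>t. (f t)\<^sup>2 \<partial>lborel) \<le> (\<integral>t. indicator {a..b} t * I\<^sup>2 \<partial>lborel)"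
      using f_sq ind f_le by (rule integral_mono)
    also have "\<dots> = L * I\<^sup>2" using ab by (simp add: L_def)
    finally have f_int: "(\<integral>t. (f t)\<^sup>2 \<partial>lborel) \<le> L * I\<^sup>2" .
    have d_pos: "0 < d l" if "l \<in> F" for l
    proof -
      have "l \<noteq> 0" using that F0 by auto
      then show ?thesis using L by (auto simp: d_def)
    qed
    have "(\<Sum>l\<in>F. d l) = (\<Sum>l\<in>F \<inter> \<Lambda>0. d l) + (\<Sum>l\<in>F - \<Lambda>0. d l)"
      using F by (simp add: sum.Int_Diff)
    also have "(\<Sum>l\<in>F \<inter> \<Lambda>0. d l) \<le> L / 32"
    proof -
      have "(\<Sum>l\<in>F \<inter> \<Lambda>0. d l) = card (F \<inter> \<Lambda>0) * (L / 32 / (card \<Lambda>0 + 1))" by (simp add: d_def)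
      also have "\<dots> \<le> (card \<Lambda>0 + 1) * (L / 32 / (card \<Lambda>0 + 1))"
        using card_mono[OF \<Lambda>0(1), of "F \<inter> \<Lambda>0"] L by (intro mult_right_mono) auto
      also have "\<dots> = L / 32"
        by (subst times_divide_eq_right, rule nonzero_mult_div_cancel_left) (use of_nat_0_le_iff[of "card \<Lambda>0"] in linarith)
      finally show ?thesis .
    qed
    also have "(\<Sum>l\<in>F - \<Lambda>0. d l) = (\<Sum>l\<in>F - \<Lambda>0. inverse \<bar>l\<bar>)" by (simp add: d_def)
    also have "\<dots> \<le> L / 32" using F by (intro tail) auto
    finally have d_sum: "(\<Sum>l\<in>F. d l) \<le> L / 16" by simp
    have M_prod: "(\<Prod>l\<in>F. M l) \<le> C"
    proof -
      have "M l = 1" if "l \<in> F - \<Lambda>0" for l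
      proof -
        have "l \<noteq> 0" using that F0 by auto
        then have "\<bar>d l * l\<bar> = 1" using that by (simp add: d_def abs_mult)
        then show ?thesis unfolding M_def by (intro max_absorb1 inverse_sinh_unit_square_le_one)
      qed
      then have "(\<Prod>l\<in>F. M l) = (\<Prod>l\<in>F \<inter> \<Lambda>0. M l)"
        using F by (simp add: prod.Int_Diff[of F M \<Lambda>0])
      also have "\<dots> \<le> C" unfolding C_def
        by (rule prod_mono2) (use \<Lambda>0 in \<open>auto simp: M_def intro: order_trans[OF zero_le_one]\<close>)
      finally show ?thesis .
    qed
    have "(L / 4) * (L / 2)\<^sup>2 \<le> ((b - \<eta>) - (a + \<eta>) - 4 * (\<Sum>l\<in>F. d l)) * (2 * \<eta>)\<^sup>2"
    proof -
      have eq: "(b - \<eta>) - (a + \<eta>) = L / 2" "2 * \<eta> = L / 2" by (simp_all add: \<eta>_def L_def field_simps)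
      show ?thesis unfolding eq using d_sum by (intro mult_right_mono) auto
    qed
    also have "\<dots> \<le> (\<Prod>l\<in>F. M l) * (\<integral>t. (f t)\<^sup>2 \<partial>lborel)"
      unfolding M_def
    proof (rule constant_term_L2_bound[OF F(1) _ d_pos f_meas f_sq])
      show "f t = 2 * \<eta> - (\<Sum>l\<in>F. (c l * (2 * sinh (\<eta> * l)) / l) * exp (l * t))"
        if "t \<in> {a + \<eta>..b - \<eta>}" for t
        using that by (simp add: f_def \<phi>_def)
    qed (use F0 in auto)
    also have "\<dots> \<le> C * (L * I\<^sup>2)"
      using M_prod f_int C by (intro mult_mono) auto
    finally have "L\<^sup>2 / (16 * C) \<le> I\<^sup>2"
      using L C by (simp add: power2_eq_square field_simps)
    then have "\<kappa> \<le> sqrt (I\<^sup>2)" unfolding \<kappa>_def by (rule real_sqrt_le_mono)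
    then show ?thesis using I by (simp add: I_def)
  qed
  moreover have "0 < \<kappa>" using L C by (simp add: \<kappa>_def)
  ultimately show ?thesis by blast
qed

lemma span_gaussian_translates:
  assumes "g \<in> cfun.span (gaussian_translates c \<Omega>)"
  shows "\<exists>F z. finite F \<and> F \<subseteq> \<Omega> \<and>
    g = (\<lambda>t. \<Sum>\<omega>\<in>F. z \<omega> * complex_of_real (exp (- c * (t - \<omega>)\<^sup>2)))"
  using assms
proof (induction rule: cfun.span_induct_alt)
  case base
  show ?case by (intro exI[of _ "{}"]) (auto simp: fun_eq_iff)
next
  case (step k x y)
  then obtain F z \<omega> where F: "finite F" "F \<subseteq> \<Omega>"
      "y = (\<lambda>t. \<Sum>\<omega>\<in>F. z \<omega> * complex_of_real (exp (- c * (t - \<omega>)\<^sup>2)))"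
    and \<omega>: "\<omega> \<in> \<Omega>" "x = (\<lambda>t. complex_of_real (exp (- c * (t - \<omega>)\<^sup>2)))"
    unfolding gaussian_translates_def by blast
  \<comment> \<open>The new centre may already belong to \<open>F\<close>, so its coefficient is added to the old one.\<close>
  define z' where "z' w = (if w \<in> F then z w else 0) + (if w = \<omega> then k else 0)" for w
  have "(\<Sum>w\<in>insert \<omega> F. z' w * e w) = k * e \<omega> + (\<Sum>w\<in>F. z w * e w)" for e :: "real \<Rightarrow> complex"
  proof -
    have "(\<Sum>w\<in>insert \<omega> F. z' w * e w) =
        (\<Sum>w\<in>insert \<omega> F. if w \<in> F then z w * e w else 0) + (\<Sum>w\<in>insert \<omega> F. if w = \<omega> then k * e w else 0)"
      unfolding sum.distrib[symmetric] by (intro sum.cong) (auto simp: z'_def algebra_simps)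
    also have "(\<Sum>w\<in>insert \<omega> F. if w \<in> F then z w * e w else 0) = (\<Sum>w\<in>F. z w * e w)"
      using F by (intro sum.mono_neutral_cong_right) auto
    also have "(\<Sum>w\<in>insert \<omega> F. if w = \<omega> then k * e w else 0) = k * e \<omega>"
      using F by (simp add: sum.delta)
    finally show ?thesis by simp
  qed
  then show ?case using F \<omega>
    by (intro exI[of _ "insert \<omega> F"] exI[of _ z']) (auto simp: fun_eq_iff)
qed

text \<open>Dividing by the Gaussian centred at \<open>\<omega>0\<close>, and taking real parts, turns a combination of Gaussians
  into a real exponential sum with the nonzero frequencies \<open>2 * c * (\<omega> - \<omega>0)\<close> and the target into
  the constant one. Moving the centre from \<open>0\<close> to \<open>\<omega>0\<close> does not affect summability.\<close>

lemma gaussian_outside_closed_span: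
  assumes sum: "(\<lambda>\<omega>. inverse \<bar>\<omega>\<bar>) summable_on (\<Omega> - {0})" and \<omega>0: "\<omega>0 \<notin> \<Omega>"
    and ab: "a < b" and c: "0 < c"
  shows "\<exists>\<kappa>>0. \<forall>g\<in>cfun.span (gaussian_translates c \<Omega>).
    \<kappa> \<le> integral {a..b} (\<lambda>t. cmod (complex_of_real (exp (- c * (t - \<omega>0)\<^sup>2)) - g t))"
proof -
  define r where "r \<omega> = 2 * c * (\<omega> - \<omega>0)" for \<omega>
  have inj: "inj_on r A" for A using c by (auto simp: inj_on_def r_def)
  have "(\<lambda>\<omega>. inverse \<bar>r \<omega>\<bar>) summable_on (\<Omega> - {0})"
  proof (rule summable_on_trans_or_large[OF sum, where d = "inverse (2 * \<bar>\<omega>0\<bar> + 1)" and C = "inverse c"])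
    fix \<omega> assume "\<omega> \<in> \<Omega> - {0}"
    then have \<omega>: "\<omega> \<noteq> 0" by simp
    show "inverse \<bar>r \<omega>\<bar> \<le> inverse c * inverse \<bar>\<omega>\<bar> \<or> inverse (2 * \<bar>\<omega>0\<bar> + 1) \<le> inverse \<bar>\<omega>\<bar>"
    proof (cases "\<bar>\<omega>\<bar> \<le> 2 * \<bar>\<omega>0\<bar> + 1")
      case True
      then show ?thesis using \<omega> by (auto intro!: le_imp_inverse_le)
    next
      case False
      then have "\<bar>\<omega>\<bar> \<le> 2 * \<bar>\<omega> - \<omega>0\<bar>"
      proof -
        have "x \<le> 2 * z" if "\<not> x \<le> 2 * y + 1" "x - y \<le> z" for x y z :: real
          using that by linarith
        then show ?thesis using False abs_triangle_ineq2[of \<omega> \<omega>0] by blast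
      qed
      then have "c * \<bar>\<omega>\<bar> \<le> \<bar>r \<omega>\<bar>" using c by (simp add: r_def abs_mult)
      then have "inverse \<bar>r \<omega>\<bar> \<le> inverse (c * \<bar>\<omega>\<bar>)" using \<omega> c by (intro le_imp_inverse_le) auto
      then show ?thesis by simp
    qed
  qed auto
  moreover have "(\<lambda>\<omega>. inverse \<bar>r \<omega>\<bar>) summable_on (\<Omega> \<inter> {0})"
    by (intro summable_on_finite) auto
  ultimately have "(\<lambda>\<omega>. inverse \<bar>r \<omega>\<bar>) summable_on ((\<Omega> - {0}) \<union> (\<Omega> \<inter> {0}))"
    by (intro summable_on_Un_disjoint) auto
  also have "(\<Omega> - {0}) \<union> (\<Omega> \<inter> {0}) = \<Omega>" by auto
  finally have "(\<lambda>l. inverse \<bar>l\<bar>) summable_on r ` \<Omega>"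
    by (subst summable_on_reindex[OF inj]) (simp add: o_def)
  moreover have "0 \<notin> r ` \<Omega>" using \<omega>0 c by (auto simp: r_def)
  ultimately obtain \<kappa> where \<kappa>: "0 < \<kappa>" "\<And>F c. finite F \<Longrightarrow> F \<subseteq> r ` \<Omega> \<Longrightarrow>
      \<kappa> \<le> integral {a..b} (\<lambda>t. \<bar>1 - (\<Sum>l\<in>F. c l * exp (l * t))\<bar>)"
    using exponential_sums_away_from_one[OF _ _ ab, of "r ` \<Omega>"] by blast
  define m where "m = exp (- c * (\<bar>a\<bar> + \<bar>b\<bar> + \<bar>\<omega>0\<bar>)\<^sup>2)"
  have m_le: "m \<le> exp (- c * (t - \<omega>0)\<^sup>2)" if "t \<in> {a..b}" for t
  proof -
    have "\<bar>t - \<omega>0\<bar> \<le> \<bar>\<bar>a\<bar> + \<bar>b\<bar> + \<bar>\<omega>0\<bar>\<bar>" using that by auto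
    then have "(t - \<omega>0)\<^sup>2 \<le> (\<bar>a\<bar> + \<bar>b\<bar> + \<bar>\<omega>0\<bar>)\<^sup>2" by (simp only: abs_le_square_iff)
    then show ?thesis using c by (simp add: m_def)
  qed
  have "m * \<kappa> \<le> integral {a..b} (\<lambda>t. cmod (complex_of_real (exp (- c * (t - \<omega>0)\<^sup>2)) - g t))"
    if g: "g \<in> cfun.span (gaussian_translates c \<Omega>)" for g
  proof -
    obtain F z where F: "finite F" "F \<subseteq> \<Omega>"
      and g_eq: "g = (\<lambda>t. \<Sum>\<omega>\<in>F. z \<omega> * complex_of_real (exp (- c * (t - \<omega>)\<^sup>2)))"
      using span_gaussian_translates[OF g] by blast
    \<comment> \<open>The coefficients are indexed by frequency, so the centre is recovered from \<open>l\<close>.\<close>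
    define c' where "c' l = (let \<omega> = l / (2 * c) + \<omega>0 in Re (z \<omega>) * exp (c * (\<omega>0\<^sup>2 - \<omega>\<^sup>2)))" for l
    have c': "c' (r \<omega>) = Re (z \<omega>) * exp (c * (\<omega>0\<^sup>2 - \<omega>\<^sup>2))" for \<omega>
      using c by (simp add: c'_def r_def Let_def)
    let ?P = "\<lambda>t. 1 - (\<Sum>l\<in>r ` F. c' l * exp (l * t))"
    have Re_eq: "Re (complex_of_real (exp (- c * (t - \<omega>0)\<^sup>2)) - g t) = exp (- c * (t - \<omega>0)\<^sup>2) * ?P t" for t
    proof -
      have e: "exp (- c * (t - \<omega>)\<^sup>2) = exp (- c * (t - \<omega>0)\<^sup>2) * (exp (c * (\<omega>0\<^sup>2 - \<omega>\<^sup>2)) * exp (r \<omega> * t))" for \<omega>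
        by (simp add: r_def algebra_simps power2_eq_square flip: exp_add)
      have "Re (complex_of_real (exp (- c * (t - \<omega>0)\<^sup>2)) - g t) =
          exp (- c * (t - \<omega>0)\<^sup>2) - (\<Sum>\<omega>\<in>F. Re (z \<omega>) * exp (- c * (t - \<omega>)\<^sup>2))"
        by (simp add: g_eq)
      also have "(\<Sum>\<omega>\<in>F. Re (z \<omega>) * exp (- c * (t - \<omega>)\<^sup>2)) =
          exp (- c * (t - \<omega>0)\<^sup>2) * (\<Sum>l\<in>r ` F. c' l * exp (l * t))"
        unfolding sum.reindex[OF inj] o_def c' sum_distrib_left
        by (intro sum.cong refl, subst e) simp
      finally show ?thesis by (simp add: right_diff_distrib)
    qed
    have "m * \<kappa> \<le> m * integral {a..b} (\<lambda>t. \<bar>?P t\<bar>)"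
      using F by (intro mult_left_mono \<kappa>(2)) (auto simp: m_def)
    also have "\<dots> = integral {a..b} (\<lambda>t. m * \<bar>?P t\<bar>)" by simp
    also have "\<dots> \<le> integral {a..b} (\<lambda>t. cmod (complex_of_real (exp (- c * (t - \<omega>0)\<^sup>2)) - g t))"
    proof (rule integral_le)
      show "(\<lambda>t. m * \<bar>?P t\<bar>) integrable_on {a..b}"
        by (intro integrable_continuous_interval continuous_intros)
      show "(\<lambda>t. cmod (complex_of_real (exp (- c * (t - \<omega>0)\<^sup>2)) - g t)) integrable_on {a..b}"
        unfolding g_eq by (intro integrable_continuous_interval continuous_intros)
      fix t assume t: "t \<in> {a..b}"
      have "m * \<bar>?P t\<bar> \<le> exp (- c * (t - \<omega>0)\<^sup>2) * \<bar>?P t\<bar>"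
        using m_le[OF t] by (intro mult_right_mono) auto
      also have "\<dots> = \<bar>Re (complex_of_real (exp (- c * (t - \<omega>0)\<^sup>2)) - g t)\<bar>"
        unfolding Re_eq by (simp add: abs_mult)
      also have "\<dots> \<le> cmod (complex_of_real (exp (- c * (t - \<omega>0)\<^sup>2)) - g t)"
        by (rule abs_Re_le_cmod)
      finally show "m * \<bar>?P t\<bar> \<le> cmod (complex_of_real (exp (- c * (t - \<omega>0)\<^sup>2)) - g t)" .
    qed
    finally show ?thesis .
  qed
  moreover have "0 < m * \<kappa>" using \<kappa>(1) by (simp add: m_def)
  ultimately show ?thesis by blast
qed


section \<open>Approximation by continuous functions in the Lebesgue seminorms\<close>

lemma powr_add_le:
  fixes x y p :: real
  assumes "0 \<le> x" "0 \<le> y" "1 \<le> p"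
  shows "(x + y) powr p \<le> 2 powr p * (x powr p + y powr p)"
proof -
  have "(x + y) powr p \<le> (2 * max x y) powr p"
    using assms by (intro powr_mono2) auto
  also have "\<dots> = 2 powr p * max x y powr p" using assms by (simp add: powr_mult)
  also have "\<dots> \<le> 2 powr p * (x powr p + y powr p)"
    by (intro mult_left_mono) (auto simp: max_def)
  finally show ?thesis .
qed

lemma continuous_integrable_on_interval:
  fixes f :: "real \<Rightarrow> 'a::euclidean_space"
  assumes "continuous_on {a..b} f"
  shows "integrable (lebesgue_on {a..b}) f"
  using continuous_imp_integrable[of a b f] assms by simp

lemma continuous_norm_powr_integrable:
  fixes f :: "real \<Rightarrow> complex"
  assumes "continuous_on {a..b} f" "1 \<le> p"
  shows "integrable (lebesgue_on {a..b}) (\<lambda>t. cmod (f t) powr p)"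
  using assms by (intro continuous_integrable_on_interval continuous_on_powr' continuous_intros) auto

lemma Lp_norm_less_iff:
  assumes "1 \<le> p" "0 < e"
  shows "Lp_norm p a b f < e \<longleftrightarrow> integral\<^sup>L (lebesgue_on {a..b}) (\<lambda>t. cmod (f t) powr p) < e powr p"
proof -
  define I where "I = integral\<^sup>L (lebesgue_on {a..b}) (\<lambda>t. cmod (f t) powr p)"
  have I: "0 \<le> I" unfolding I_def by simp
  have "(I powr (1 / p)) powr p = I" "(e powr p) powr (1 / p) = e"
    using I assms by (simp_all add: powr_powr)
  then have "I powr (1 / p) < e \<longleftrightarrow> I < e powr p"
    using assms I powr_less_mono2[of p "I powr (1 / p)" e] powr_less_mono2[of "1 / p" I "e powr p"]
    by auto
  then show ?thesis by (simp add: Lp_norm_def I_def)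
qed

text \<open>A measurable function is almost everywhere a limit of continuous functions. Composing these with
  the retraction of the plane onto a disc that contains the values of \<open>f\<close> makes
  them uniformly bounded, so that dominated convergence applies.\<close>

lemma bounded_measurable_approx_continuous:
  fixes f :: "real \<Rightarrow> complex"
  assumes f: "f \<in> borel_measurable (lebesgue_on {a..b})" and bound: "\<And>t. cmod (f t) \<le> K"
    and p: "1 \<le> p" and e: "0 < e"
  shows "\<exists>h. continuous_on UNIV h \<and> integral\<^sup>L (lebesgue_on {a..b}) (\<lambda>t. cmod (f t - h t) powr p) < e"
proof -
  let ?M = "lebesgue_on {a..b}"
  have "f measurable_on {a..b}" using f by (simp add: measurable_on_iff_borel_measurable)
  then obtain N g where N: "negligible N" and g: "\<And>n. continuous_on UNIV (g n)"
    and lim: "\<And>t. t \<notin> N \<Longrightarrow> (\<lambda>n. g n t) \<longlonglongrightarrow> (if t \<in> {a..b} then f t else 0)"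
    unfolding measurable_on_def by blast
  have K: "0 \<le> K" using bound[of 0] norm_ge_zero[of "f 0"] by linarith
  define P where "P = closest_point (cball (0 :: complex) K)"
  have P_cont: "continuous_on A P" for A
    unfolding P_def using K by (intro continuous_on_closest_point) auto
  have P_bound: "cmod (P z) \<le> K" for z
    using closest_point_in_set[of "cball 0 K" z] K by (auto simp: P_def)
  have P_f: "P (f t) = f t" for t
    unfolding P_def using bound by (intro closest_point_self) auto
  have Pg: "continuous_on UNIV (\<lambda>t. P (g n t))" for n
    by (rule continuous_on_compose2[OF P_cont[of UNIV] g]) auto
  have Pg_meas: "(\<lambda>t. P (g n t)) \<in> borel_measurable ?M" for n
    using Pg by (intro continuous_imp_measurable_on_sets_lebesgue) (auto intro: continuous_on_subset)
  have "(\<lambda>n. integral\<^sup>L ?M (\<lambda>t. cmod (f t - P (g n t)) powr p)) \<longlonglongrightarrow> integral\<^sup>L ?M (\<lambda>t. 0)"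
  proof (rule integral_dominated_convergence[where w = "\<lambda>_. (2 * K) powr p"])
    show "(\<lambda>t. cmod (f t - P (g n t)) powr p) \<in> borel_measurable ?M" for n
      using f Pg_meas[of n] by measurable
    have "AE t in lebesgue. t \<notin> N"
      using N by (intro AE_not_in) (simp add: negligible_iff_null_sets)
    then show "AE t in ?M. (\<lambda>n. cmod (f t - P (g n t)) powr p) \<longlonglongrightarrow> 0"
    proof (subst AE_restrict_space_iff)
      assume "AE t in lebesgue. t \<notin> N"
      then show "AE t in lebesgue. t \<in> {a..b} \<longrightarrow> (\<lambda>n. cmod (f t - P (g n t)) powr p) \<longlonglongrightarrow> 0"
      proof eventually_elim
        case (elim t)
        show ?case
        proof
          assume "t \<in> {a..b}"
          then have "(\<lambda>n. g n t) \<longlonglongrightarrow> f t" using lim[OF elim] by simp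
          then have "(\<lambda>n. P (g n t)) \<longlonglongrightarrow> P (f t)"
            using P_cont[of UNIV] continuous_on_tendsto_compose[of UNIV P] by auto
          then have "(\<lambda>n. cmod (f t - P (g n t))) \<longlonglongrightarrow> 0"
            unfolding P_f by (intro tendsto_norm_zero tendsto_eq_intros) auto
          then have "(\<lambda>n. cmod (f t - P (g n t)) powr p) \<longlonglongrightarrow> 0 powr p"
            using p by (intro tendsto_powr') auto
          then show "(\<lambda>n. cmod (f t - P (g n t)) powr p) \<longlonglongrightarrow> 0" by simp
        qed
      qed
    qed auto
    have "cmod (f t - P (g n t)) \<le> 2 * K" for n t
      using norm_triangle_ineq4[of "f t" "P (g n t)"] bound[of t] P_bound[of "g n t"] by linarith
    then show "AE t in ?M. norm (cmod (f t - P (g n t)) powr p) \<le> (2 * K) powr p" for n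
      using p by (intro AE_I2) (auto intro!: powr_mono2)
  qed auto
  then have "eventually (\<lambda>n. integral\<^sup>L ?M (\<lambda>t. cmod (f t - P (g n t)) powr p) < e) sequentially"
    using e by (intro order_tendstoD(2)) auto
  then obtain n where "integral\<^sup>L ?M (\<lambda>t. cmod (f t - P (g n t)) powr p) < e"
    by (auto simp: eventually_sequentially)
  then show ?thesis using Pg by blast
qed

lemma Lp_truncation_small:
  fixes f :: "real \<Rightarrow> complex"
  assumes f: "f \<in> Lp_space p a b" and p: "1 \<le> p" and e: "0 < e"
  shows "\<exists>K. integral\<^sup>L (lebesgue_on {a..b}) (\<lambda>t. cmod (f t - (if cmod (f t) \<le> K then f t else 0)) powr p) < e"
proof -
  let ?M = "lebesgue_on {a..b}"
  have fm: "f \<in> borel_measurable ?M" and fi: "integrable ?M (\<lambda>t. cmod (f t) powr p)"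
    using f by (auto simp: Lp_space_def)
  \<comment> \<open>The truncations converge because they are eventually equal to \<open>f\<close> at each point.\<close>
  define u where "u n t = (if cmod (f t) \<le> real n then f t else 0)" for n t
  have "(\<lambda>n. integral\<^sup>L ?M (\<lambda>t. cmod (f t - u n t) powr p)) \<longlonglongrightarrow> integral\<^sup>L ?M (\<lambda>t. 0)"
  proof (rule integral_dominated_convergence[OF _ _ fi])
    show "(\<lambda>t. cmod (f t - u n t) powr p) \<in> borel_measurable ?M" for n
      using fm unfolding u_def by measurable
    show "AE t in ?M. (\<lambda>n. cmod (f t - u n t) powr p) \<longlonglongrightarrow> 0"
    proof (intro AE_I2 tendsto_eventually)
      fix t
      obtain m :: nat where "cmod (f t) \<le> real m" using real_arch_simple by blast
      then show "eventually (\<lambda>n. cmod (f t - u n t) powr p = 0) sequentially"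
        using p by (intro eventually_sequentiallyI[of m]) (auto simp: u_def)
    qed
    show "AE t in ?M. norm (cmod (f t - u n t) powr p) \<le> cmod (f t) powr p" for n
      using p by (intro AE_I2) (auto simp: u_def)
  qed auto
  then have "eventually (\<lambda>n. integral\<^sup>L ?M (\<lambda>t. cmod (f t - u n t) powr p) < e) sequentially"
    using e by (intro order_tendstoD(2)) auto
  then show ?thesis by (auto simp: eventually_sequentially u_def)
qed

lemma integral_norm_diff_powr_triangle:
  fixes f g h :: "real \<Rightarrow> complex"
  assumes p: "1 \<le> p"
    and fg: "integrable (lebesgue_on {a..b}) (\<lambda>t. cmod (f t - g t) powr p)"
    and gh: "integrable (lebesgue_on {a..b}) (\<lambda>t. cmod (g t - h t) powr p)"
  shows "integral\<^sup>L (lebesgue_on {a..b}) (\<lambda>t. cmod (f t - h t) powr p) \<le>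
    2 powr p * (integral\<^sup>L (lebesgue_on {a..b}) (\<lambda>t. cmod (f t - g t) powr p) +
                integral\<^sup>L (lebesgue_on {a..b}) (\<lambda>t. cmod (g t - h t) powr p))"
proof -
  have "integral\<^sup>L (lebesgue_on {a..b}) (\<lambda>t. cmod (f t - h t) powr p) \<le>
      integral\<^sup>L (lebesgue_on {a..b}) (\<lambda>t. 2 powr p * (cmod (f t - g t) powr p + cmod (g t - h t) powr p))"
  proof (rule integral_mono')
    show "integrable (lebesgue_on {a..b}) (\<lambda>t. 2 powr p * (cmod (f t - g t) powr p + cmod (g t - h t) powr p))"
      using fg gh by (intro integrable_mult_right Bochner_Integration.integrable_add)
    fix t
    have "cmod (f t - h t) powr p \<le> (cmod (f t - g t) + cmod (g t - h t)) powr p"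
      using p norm_triangle_ineq[of "f t - g t" "g t - h t"] by (intro powr_mono2) auto
    also have "\<dots> \<le> 2 powr p * (cmod (f t - g t) powr p + cmod (g t - h t) powr p)"
      using p by (intro powr_add_le) auto
    finally show "cmod (f t - h t) powr p \<le> 2 powr p * (cmod (f t - g t) powr p + cmod (g t - h t) powr p)" .
  qed auto
  then show ?thesis using fg gh by simp
qed

lemma Lp_norm_powr_integrable_diff:
  fixes f g :: "real \<Rightarrow> complex"
  assumes f: "f \<in> Lp_space p a b" and g: "g \<in> Lp_space p a b" and p: "1 \<le> p"
  shows "integrable (lebesgue_on {a..b}) (\<lambda>t. cmod (f t - g t) powr p)"
proof (rule Bochner_Integration.integrable_bound)
  show "integrable (lebesgue_on {a..b}) (\<lambda>t. 2 powr p * (cmod (f t) powr p + cmod (g t) powr p))"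
    using f g by (intro integrable_mult_right Bochner_Integration.integrable_add) (auto simp: Lp_space_def)
  show "(\<lambda>t. cmod (f t - g t) powr p) \<in> borel_measurable (lebesgue_on {a..b})"
    using f g unfolding Lp_space_def by auto
  have "cmod (f t - g t) powr p \<le> 2 powr p * (cmod (f t) powr p + cmod (g t) powr p)" for t
  proof -
    have "cmod (f t - g t) powr p \<le> (cmod (f t) + cmod (g t)) powr p"
      using p norm_triangle_ineq4[of "f t" "g t"] by (intro powr_mono2) auto
    also have "\<dots> \<le> 2 powr p * (cmod (f t) powr p + cmod (g t) powr p)"
      using p by (intro powr_add_le) auto
    finally show ?thesis .
  qed
  then show "AE t in lebesgue_on {a..b}. norm (cmod (f t - g t) powr p) \<le> norm (2 powr p * (cmod (f t) powr p + cmod (g t) powr p))"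
    by (intro AE_I2) auto
qed

lemma continuous_in_Lp_space:
  assumes "continuous_on {a..b} f" "1 \<le> p"
  shows "f \<in> Lp_space p a b"
  using assms continuous_norm_powr_integrable continuous_imp_measurable_on_sets_lebesgue[of "{a..b}" f]
  by (auto simp: Lp_space_def)

lemma Lp_approx_continuous:
  fixes f :: "real \<Rightarrow> complex"
  assumes f: "f \<in> Lp_space p a b" and p: "1 \<le> p" and e: "0 < e"
  shows "\<exists>h. continuous_on {a..b} h \<and> integral\<^sup>L (lebesgue_on {a..b}) (\<lambda>t. cmod (f t - h t) powr p) < e"
proof -
  let ?M = "lebesgue_on {a..b}"
  define d where "d = e / (2 * 2 powr p)"
  have d: "0 < d" using e by (simp add: d_def)
  obtain K where K: "integral\<^sup>L ?M (\<lambda>t. cmod (f t - (if cmod (f t) \<le> K then f t else 0)) powr p) < d"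
    using Lp_truncation_small[OF f p d] by blast
  define u where "u t = (if cmod (f t) \<le> K then f t else 0)" for t
  have fm: "f \<in> borel_measurable ?M" using f by (simp add: Lp_space_def)
  have um: "u \<in> borel_measurable ?M" using fm unfolding u_def by measurable
  have u_Lp: "u \<in> Lp_space p a b"
    unfolding Lp_space_def
  proof safe
    show "integrable ?M (\<lambda>t. cmod (u t) powr p)"
    proof (rule Bochner_Integration.integrable_bound)
      show "integrable ?M (\<lambda>t. cmod (f t) powr p)" using f by (simp add: Lp_space_def)
      show "(\<lambda>t. cmod (u t) powr p) \<in> borel_measurable ?M" using um by measurable
    qed (use p in \<open>auto simp: u_def\<close>)
  qed fact
  obtain h where h: "continuous_on UNIV h" "integral\<^sup>L ?M (\<lambda>t. cmod (u t - h t) powr p) < d"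
  proof -
    have "cmod (u t) \<le> \<bar>K\<bar>" for t by (auto simp: u_def)
    then show ?thesis using bounded_measurable_approx_continuous[OF um _ p d] that by blast
  qed
  have h': "continuous_on {a..b} h" using h(1) continuous_on_subset by blast
  have "integral\<^sup>L ?M (\<lambda>t. cmod (f t - h t) powr p) \<le> 2 powr p *
      (integral\<^sup>L ?M (\<lambda>t. cmod (f t - u t) powr p) + integral\<^sup>L ?M (\<lambda>t. cmod (u t - h t) powr p))"
    using f u_Lp p continuous_in_Lp_space[OF h' p]
    by (intro integral_norm_diff_powr_triangle Lp_norm_powr_integrable_diff)
  also have "\<dots> < 2 powr p * (d + d)"
    using K h(2) by (intro mult_strict_left_mono add_strict_mono) (auto simp: u_def)
  also have "\<dots> = e" by (simp add: d_def field_simps)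
  finally show ?thesis using h' by blast
qed


section \<open>From approximation to completeness\<close>

lemma gaussian_continuous: "continuous_on A (\<lambda>t. complex_of_real (exp (- c * (t - \<omega>)\<^sup>2)))"
  by (intro continuous_intros)

lemma span_gaussians_continuous:
  assumes "g \<in> cfun.span (gaussian_translates c \<Omega>)"
  shows "continuous_on A g"
proof -
  obtain F z where "g = (\<lambda>t. \<Sum>\<omega>\<in>F. z \<omega> * complex_of_real (exp (- c * (t - \<omega>)\<^sup>2)))"
    using span_gaussian_translates[OF assms] by blast
  then show ?thesis by (auto intro!: continuous_intros)
qed

lemma gaussian_translates_continuous: "f \<in> gaussian_translates c \<Omega> \<Longrightarrow> continuous_on A f"
  by (auto simp: gaussian_translates_def intro!: continuous_intros)

lemma complete_in_C_if_dense:
  assumes ab: "a < b"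
    and dense: "\<And>f. continuous_on {a..b} f \<Longrightarrow> f \<in> uniform_closure {a..b} (gaussian_translates c \<Omega>)"
  shows "complete_in (C_space a b) (sup_norm a b) (gaussian_translates c \<Omega>)"
  unfolding complete_in_def
proof (intro conjI ballI allI impI)
  show "gaussian_translates c \<Omega> \<subseteq> C_space a b"
    by (auto simp: C_space_def gaussian_translates_continuous)
  fix f and e :: real assume f: "f \<in> C_space a b" and e: "0 < e"
  then have e2: "0 < e / 2" by simp
  obtain g where g: "g \<in> cfun.span (gaussian_translates c \<Omega>)" "\<And>t. t \<in> {a..b} \<Longrightarrow> cmod (f t - g t) < e / 2"
    using dense[of f] f e2 unfolding C_space_def uniform_closure_def by blast
  have "sup_norm a b (\<lambda>t. f t - g t) \<le> e / 2"
    unfolding sup_norm_def using ab g(2) by (intro cSUP_least) (auto intro: less_imp_le)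
  then show "\<exists>g\<in>cfun.span (gaussian_translates c \<Omega>). sup_norm a b (\<lambda>t. f t - g t) < e"
    using g(1) e by (intro bexI[of _ g]) auto
qed

lemma complete_in_Lp_if_dense:
  assumes ab: "a < b" and p: "1 \<le> p"
    and dense: "\<And>f. continuous_on {a..b} f \<Longrightarrow> f \<in> uniform_closure {a..b} (gaussian_translates c \<Omega>)"
  shows "complete_in (Lp_space p a b) (Lp_norm p a b) (gaussian_translates c \<Omega>)"
  unfolding complete_in_def
proof (intro conjI ballI allI impI)
  show "gaussian_translates c \<Omega> \<subseteq> Lp_space p a b"
    using p by (auto intro!: continuous_in_Lp_space gaussian_translates_continuous)
  let ?M = "lebesgue_on {a..b}"
  fix f and e :: real assume f: "f \<in> Lp_space p a b" and e: "0 < e"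
  define d where "d = e powr p / (2 * 2 powr p)"
  have d: "0 < d" using e by (simp add: d_def)
  obtain h where h: "continuous_on {a..b} h" "integral\<^sup>L ?M (\<lambda>t. cmod (f t - h t) powr p) < d"
    using Lp_approx_continuous[OF f p d] by blast
  define r where "r = (d / (b - a)) powr (1 / p)"
  have r: "0 < r" using d ab by (simp add: r_def)
  have rp: "r powr p * (b - a) = d" using d ab p by (simp add: r_def powr_powr)
  obtain g where g: "g \<in> cfun.span (gaussian_translates c \<Omega>)" "\<And>t. t \<in> {a..b} \<Longrightarrow> cmod (h t - g t) < r"
    using dense[OF h(1)] r unfolding uniform_closure_def by blast
  have g_Lp: "g \<in> Lp_space p a b" and h_Lp: "h \<in> Lp_space p a b"
    using span_gaussians_continuous[OF g(1)] h(1) p by (auto intro!: continuous_in_Lp_space)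
  have "integral\<^sup>L ?M (\<lambda>t. cmod (h t - g t) powr p) \<le> integral\<^sup>L ?M (\<lambda>t. r powr p)"
    using g(2) p r by (intro integral_mono' powr_mono2) (auto intro: less_imp_le)
  also have "\<dots> = d" using ab rp by (simp add: measure_restrict_space mult.commute)
  finally have hg: "integral\<^sup>L ?M (\<lambda>t. cmod (h t - g t) powr p) \<le> d" .
  have "integral\<^sup>L ?M (\<lambda>t. cmod (f t - g t) powr p) \<le> 2 powr p *
      (integral\<^sup>L ?M (\<lambda>t. cmod (f t - h t) powr p) + integral\<^sup>L ?M (\<lambda>t. cmod (h t - g t) powr p))"
    using f g_Lp h_Lp p by (intro integral_norm_diff_powr_triangle Lp_norm_powr_integrable_diff)
  also have "\<dots> < 2 powr p * (d + d)"
    using h(2) hg by (intro mult_strict_left_mono add_less_le_mono) auto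
  also have "\<dots> = e powr p" by (simp add: d_def field_simps)
  finally have "Lp_norm p a b (\<lambda>t. f t - g t) < e" using p e by (simp add: Lp_norm_less_iff)
  then show "\<exists>g\<in>cfun.span (gaussian_translates c \<Omega>). Lp_norm p a b (\<lambda>t. f t - g t) < e"
    using g(1) by blast
qed

lemma not_complete_in_C:
  assumes ab: "a < b" and h: "continuous_on {a..b} h" and \<kappa>: "0 < \<kappa>"
    and far: "\<And>g. g \<in> cfun.span S \<Longrightarrow> \<kappa> \<le> integral {a..b} (\<lambda>t. cmod (h t - g t))"
    and cont: "\<And>g. g \<in> cfun.span S \<Longrightarrow> continuous_on {a..b} g"
  shows "\<not> complete_in (C_space a b) (sup_norm a b) S"
proof
  assume complete: "complete_in (C_space a b) (sup_norm a b) S"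
  have "h \<in> C_space a b" using h by (simp add: C_space_def)
  moreover have "0 < \<kappa> / (b - a)" using \<kappa> ab by simp
  ultimately obtain g where g: "g \<in> cfun.span S" "sup_norm a b (\<lambda>t. h t - g t) < \<kappa> / (b - a)"
    using complete unfolding complete_in_def by blast
  have u: "continuous_on {a..b} (\<lambda>t. cmod (h t - g t))" using h cont[OF g(1)] by (intro continuous_intros)
  then have bdd: "bdd_above ((\<lambda>t. cmod (h t - g t)) ` {a..b})"
    by (intro bounded_imp_bdd_above compact_imp_bounded compact_continuous_image) auto
  have "\<kappa> \<le> integral {a..b} (\<lambda>t. cmod (h t - g t))" by (rule far[OF g(1)])
  also have "\<dots> \<le> integral {a..b} (\<lambda>t. sup_norm a b (\<lambda>t. h t - g t))"
  proof (rule integral_le)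
    show "(\<lambda>t. cmod (h t - g t)) integrable_on {a..b}" using u by (rule integrable_continuous_interval)
    show "(\<lambda>t. sup_norm a b (\<lambda>t. h t - g t)) integrable_on {a..b}" by (rule integrable_const_ivl)
    show "cmod (h t - g t) \<le> sup_norm a b (\<lambda>t. h t - g t)" if "t \<in> {a..b}" for t
      unfolding sup_norm_def using bdd that by (intro cSUP_upper)
  qed
  also have "\<dots> = (b - a) * sup_norm a b (\<lambda>t. h t - g t)" using ab by simp
  also have "\<dots> < \<kappa>" using g(2) ab by (simp add: field_simps)
  finally show False by simp
qed

text \<open>Smallness of the \<open>p\<close>-th power integral forces smallness of the \<open>L\<^sup>1\<close> norm by the pointwise
  inequality \<open>x \<le> d + d powr (1 - p) * x powr p\<close>, whose second term dominates where \<open>x \<ge> d\<close>.\<close>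

lemma not_complete_in_Lp:
  assumes ab: "a < b" and p: "1 \<le> p" and h: "continuous_on {a..b} h" and \<kappa>: "0 < \<kappa>"
    and far: "\<And>g. g \<in> cfun.span S \<Longrightarrow> \<kappa> \<le> integral {a..b} (\<lambda>t. cmod (h t - g t))"
    and cont: "\<And>g. g \<in> cfun.span S \<Longrightarrow> continuous_on {a..b} g"
  shows "\<not> complete_in (Lp_space p a b) (Lp_norm p a b) S"
proof
  assume complete: "complete_in (Lp_space p a b) (Lp_norm p a b) S"
  let ?M = "lebesgue_on {a..b}"
  define d where "d = \<kappa> / (2 * (b - a))"
  have d: "0 < d" using \<kappa> ab by (simp add: d_def)
  \<comment> \<open>With these values each of the two terms of the pointwise bound integrates to at most
    \<open>\<kappa> / 2\<close>, the second one strictly less.\<close>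
  define e where "e = (\<kappa> / 2 * d powr (p - 1)) powr (1 / p)"
  have e: "0 < e" using \<kappa> d by (simp add: e_def)
  have ep: "e powr p = \<kappa> / 2 * d powr (p - 1)" using \<kappa> d p by (simp add: e_def powr_powr)
  have "h \<in> Lp_space p a b" using h p by (rule continuous_in_Lp_space)
  then obtain g where g: "g \<in> cfun.span S" "Lp_norm p a b (\<lambda>t. h t - g t) < e"
    using complete e unfolding complete_in_def by blast
  have u: "continuous_on {a..b} (\<lambda>t. h t - g t)" using h cont[OF g(1)] by (intro continuous_intros)
  have small: "integral\<^sup>L ?M (\<lambda>t. cmod (h t - g t) powr p) < \<kappa> / 2 * d powr (p - 1)"
    using g(2) unfolding Lp_norm_less_iff[OF p e] ep .
  have bound: "x \<le> d + x powr p * d powr (1 - p)" if "0 \<le> x" for x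
  proof (cases "x \<le> d")
    case True
    then show ?thesis by (simp add: add_increasing2)
  next
    case False
    then have "x = x powr p * x powr (1 - p)" using d by (simp flip: powr_add)
    also have "\<dots> \<le> x powr p * d powr (1 - p)"
      using False d p by (intro mult_left_mono powr_mono2') auto
    finally show ?thesis using d by simp
  qed
  have int_p: "integrable ?M (\<lambda>t. cmod (h t - g t) powr p)" using u p by (rule continuous_norm_powr_integrable)
  have int_1: "integrable ?M (\<lambda>t. cmod (h t - g t))"
    by (rule continuous_integrable_on_interval[OF continuous_on_norm[OF u]])
  have "\<kappa> \<le> integral {a..b} (\<lambda>t. cmod (h t - g t))" by (rule far[OF g(1)])
  also have "\<dots> = integral\<^sup>L ?M (\<lambda>t. cmod (h t - g t))"
    using int_1 by (simp add: lebesgue_integral_eq_integral)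
  also have "\<dots> \<le> integral\<^sup>L ?M (\<lambda>t. d + cmod (h t - g t) powr p * d powr (1 - p))"
    using int_1 int_p bound by (intro integral_mono) auto
  also have "\<dots> = d * (b - a) + integral\<^sup>L ?M (\<lambda>t. cmod (h t - g t) powr p) * d powr (1 - p)"
    using int_p ab by (simp add: measure_restrict_space mult.commute)
  also have "\<dots> < d * (b - a) + \<kappa> / 2 * d powr (p - 1) * d powr (1 - p)"
    using small d by (intro add_strict_left_mono mult_strict_right_mono) auto
  also have "d * (b - a) = \<kappa> / 2" using ab by (simp add: d_def field_simps)
  also have "\<kappa> / 2 + \<kappa> / 2 * d powr (p - 1) * d powr (1 - p) = \<kappa>"
    using d by (simp add: mult.assoc flip: powr_add)
  finally show False by simp
qed

theorem theorem2p6: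
  fixes p a b c :: real and \<Omega> :: "real set"
  assumes "1 \<le> p" and "a < b" and "0 < c" and "countable \<Omega>"
  shows "(complete_in (Lp_space p a b) (Lp_norm p a b) (gaussian_translates c \<Omega>)
            \<longleftrightarrow> \<not> (\<lambda>\<omega>. inverse \<bar>\<omega>\<bar>) summable_on (\<Omega> - {0}))
       \<and> (complete_in (C_space a b) (sup_norm a b) (gaussian_translates c \<Omega>)
            \<longleftrightarrow> \<not> (\<lambda>\<omega>. inverse \<bar>\<omega>\<bar>) summable_on (\<Omega> - {0}))"
proof (cases "(\<lambda>\<omega>. inverse \<bar>\<omega>\<bar>) summable_on (\<Omega> - {0})")
  case True
  obtain \<omega>0 where \<omega>0: "\<omega>0 \<notin> \<Omega>"
    using \<open>countable \<Omega>\<close> uncountable_UNIV_real by (metis UNIV_eq_I)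
  obtain \<kappa> where \<kappa>: "0 < \<kappa>" "\<And>g. g \<in> cfun.span (gaussian_translates c \<Omega>) \<Longrightarrow>
      \<kappa> \<le> integral {a..b} (\<lambda>t. cmod (complex_of_real (exp (- c * (t - \<omega>0)\<^sup>2)) - g t))"
    using gaussian_outside_closed_span[OF True \<omega>0 assms(2,3)] by blast
  have "\<not> complete_in (Lp_space p a b) (Lp_norm p a b) (gaussian_translates c \<Omega>)"
    by (rule not_complete_in_Lp[OF assms(2,1) gaussian_continuous \<kappa> span_gaussians_continuous])
  moreover have "\<not> complete_in (C_space a b) (sup_norm a b) (gaussian_translates c \<Omega>)"
    by (rule not_complete_in_C[OF assms(2) gaussian_continuous \<kappa> span_gaussians_continuous])
  ultimately show ?thesis using True by blast
next
  case False
  have dense: "f \<in> uniform_closure {a..b} (gaussian_translates c \<Omega>)" if "continuous_on {a..b} f" for f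
    using False that assms by (intro continuous_in_closure_gaussians) auto
  then show ?thesis
    using False assms complete_in_Lp_if_dense[of a b p c \<Omega>] complete_in_C_if_dense[of a b c \<Omega>] by blast
qed

end
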